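(* Let $u$ and $v$ be inner functions on $\mathbb{D}$, with $u$ nonconstant and $v = uI$ for some inner function $I$. Suppose further that $\sigma(u) \cap \sigma(I) = \varnothing$. Then $\mathscr{M}(u,v) = \mathcal{K}_{zI}$. Furthermore, if $I$ is not a finite Blaschke product, then $\mathscr{M}(u,v)$ contains unbounded functions.
   Context: $\mathbb{D}$ is the open unit disk, $\mathbb{T}$ the unit circle, $H^2$ the Hardy space of $\mathbb{D}$. For an inner function $\Theta$, $\mathcal{K}_{\Theta} := H^2 \cap (\Theta H^2)^{\perp}$; $\mathcal{K}_{zI}$ is the model space of the inner function $z\mapsto zI(z)$. $\mathscr{M}(u,v) := \{\varphi \in \operatorname{Hol}(\mathbb{D}) : \varphi \mathcal{K}_u \subseteq \mathcal{K}_v\}$. The boundary spectrum of an inner function $u$ is $\sigma(u) := \{\xi \in \mathbb{T} : \liminf_{z \to \xi,\ z\in\mathbb{D}} |u(z)| = 0\}$. Unimodular constants count as finite Blaschke products (with no zeros). *)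

theory Defs
  imports "HOL-Complex_Analysis.Complex_Analysis"
begin

text \<open>
  A function on the open unit disk is represented by a total function on \<^typ>\<open>complex\<close>. Every
  definition below depends only on its values on \<^term>\<open>ball (0::complex) 1\<close>, so the sets of
  functions are closed under changing a function off the disk, and equality of two such sets is
  equality of the corresponding sets of functions on the disk.
\<close>

definition taylor_coeff :: "(complex \<Rightarrow> complex) \<Rightarrow> nat \<Rightarrow> complex" where
  "taylor_coeff f n = (deriv ^^ n) f 0 / fact n"

definition hardy2 :: "(complex \<Rightarrow> complex) set" where
  "hardy2 = {f. f holomorphic_on ball 0 1 \<and> summable (\<lambda>n. (cmod (taylor_coeff f n))\<^sup>2)}"

text \<open>
  The series converges absolutely for \<open>f\<close> and \<open>g\<close> in \<^term>\<open>hardy2\<close>, by Cauchy--Schwarz.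
\<close>

definition hardy2_inner :: "(complex \<Rightarrow> complex) \<Rightarrow> (complex \<Rightarrow> complex) \<Rightarrow> complex" where
  "hardy2_inner f g = (\<Sum>n. taylor_coeff f n * cnj (taylor_coeff g n))"

definition hardy2_orthogonal :: "(complex \<Rightarrow> complex) set \<Rightarrow> (complex \<Rightarrow> complex) set" where
  "hardy2_orthogonal S = {f \<in> hardy2. \<forall>g\<in>S. hardy2_inner f g = 0}"

definition inner_function :: "(complex \<Rightarrow> complex) \<Rightarrow> bool" where
  "inner_function u \<longleftrightarrow>
     u holomorphic_on ball 0 1 \<and> bounded (u ` ball 0 1) \<and>
     (AE t in lebesgue_on {0..2 * pi}.
        \<exists>l. ((\<lambda>r. u (of_real r * cis t)) \<longlongrightarrow> l) (at_left 1) \<and> cmod l = 1)"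

definition model_space :: "(complex \<Rightarrow> complex) \<Rightarrow> (complex \<Rightarrow> complex) set" where
  "model_space \<Theta> = hardy2 \<inter> hardy2_orthogonal ((\<lambda>h z. \<Theta> z * h z) ` hardy2)"

definition multipliers :: "(complex \<Rightarrow> complex) \<Rightarrow> (complex \<Rightarrow> complex) \<Rightarrow> (complex \<Rightarrow> complex) set"
  where
  "multipliers u v =
     {\<phi>. \<phi> holomorphic_on ball 0 1 \<and> (\<lambda>f z. \<phi> z * f z) ` model_space u \<subseteq> model_space v}"

definition boundary_spectrum :: "(complex \<Rightarrow> complex) \<Rightarrow> complex set" where
  "boundary_spectrum u =
     {\<xi> \<in> sphere 0 1. Liminf (at \<xi> within ball 0 1) (\<lambda>z. ereal (cmod (u z))) = 0}"

text \<open>The list \<open>as\<close> holds the zeros with multiplicity; it is empty for a unimodular constant.\<close>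

definition finite_blaschke_product :: "(complex \<Rightarrow> complex) \<Rightarrow> bool" where
  "finite_blaschke_product B \<longleftrightarrow>
     (\<exists>c as. cmod c = 1 \<and> set as \<subseteq> ball 0 1 \<and>
        (\<forall>z\<in>ball 0 1. B z = c * (\<Prod>a\<leftarrow>as. (z - a) / (1 - cnj a * z))))"

end

theory Submission
  imports Defs
begin

text \<open>
  Let \<open>\<langle>f, g\<rangle>\<close> be the inner product of the Hardy space and \<open>K(\<Theta>)\<close> the model space of \<open>\<Theta>\<close>. Multiplication by
  an inner function is isometric, and so is multiplication by \<open>z\<close>; an element \<open>f\<close> of the Hardy space
  belongs to \<open>K(\<Theta>)\<close> when \<open>\<langle>f, \<Theta> h\<rangle> = 0\<close> for all \<open>h\<close>.
  
  A multiplier \<open>\<phi>\<close> from \<open>K(u)\<close> to \<open>K(u I)\<close> must map the kernel \<open>1 - cnj (u 0) u\<close> and the backward shift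
  \<open>(u - u 0) / z\<close> into \<open>K(u I)\<close>. The kernel is invertible among bounded functions because \<open>|u 0| < 1\<close>, so
  \<open>\<phi>\<close> is in the Hardy space, and cancelling \<open>u\<close> in the orthogonality relations for the backward shift leaves
  exactly \<open>\<phi> \<in> K(z I)\<close> (\<open>multipliers_subset_model_space\<close>).
  
  The spectra enter in the converse. Evaluation at \<open>z\<close> on \<open>K(\<Theta>)\<close> has squared norm
  \<open>(1 - |\<Theta> z|\<^sup>2) / (1 - |z|\<^sup>2)\<close>. Near a boundary point where \<open>\<Theta>\<close> is bounded away from \<open>0\<close>, Schwarz reflection across
  the circle, in the form of a Poisson integral estimate for \<open>\<Theta>\<close> and \<open>1/\<Theta>\<close> on a small rectangle, shows that
  this quotient stays bounded (\<open>reflection_estimate\<close>, \<open>kernel_growth_bounded_near\<close>). As the spectra are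
  disjoint, there is one constant that at each point of the disk bounds the unit ball of \<open>K(u)\<close> or that of
  \<open>K(z I)\<close>, so products \<open>\<phi> f\<close> lie in the Hardy space and depend continuously on \<open>\<phi>\<close>. For the projections of
  monomials onto \<open>K(z I)\<close>, which span a dense subspace, the product with \<open>f \<in> K(u)\<close> is seen to be
  orthogonal to \<open>u I h\<close> by an algebraic computation (\<open>monomial_projection_mult\<close>); closedness of \<open>K(u I)\<close>
  does the rest (\<open>model_space_subset_multipliers\<close>).
  
  If all elements of \<open>K(z I)\<close> were bounded, the evaluation norms would be bounded by the uniform boundedness principle
  (\<open>model_space_has_unbounded_element\<close>), so \<open>|I|\<close> would be bounded below near the circle; then \<open>I\<close> has finitely many zeros,
  and dividing by the corresponding Blaschke product leaves a unimodular constant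
  (\<open>finite_blaschke_product_if_bounded_below\<close>).
  
  Boundary values of general elements of the Hardy space are avoided: norms are limits of means over
  circles, and radial limits are only taken of inner functions and of polynomials.
\<close>

abbreviation disk :: "complex set" where
  "disk \<equiv> ball 0 1"

section \<open>Taylor coefficients\<close>

lemma taylor_coeff_sums:
  assumes "f holomorphic_on disk" "z \<in> disk"
  shows "(\<lambda>n. taylor_coeff f n * z ^ n) sums f z"
  using holomorphic_power_series[OF assms] by (simp add: taylor_coeff_def)

lemma taylor_coeff_unique:
  assumes "\<And>z. z \<in> disk \<Longrightarrow> (\<lambda>n. a n * z ^ n) sums f z"
  shows "f holomorphic_on disk" "taylor_coeff f n = a n"
proof -
  show "f holomorphic_on disk"
    by (rule power_series_holomorphic[where a = a]) (use assms in auto)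
  have "f has_fps_expansion Abs_fps a"
    by (rule has_fps_expansionI)
       (use assms in \<open>auto intro!: eventually_nhds_in_open[of disk, THEN eventually_mono]\<close>)
  from fps_nth_fps_expansion[OF this, of n] show "taylor_coeff f n = a n"
    by (simp add: taylor_coeff_def)
qed

lemma taylor_coeff_cong:
  assumes "f holomorphic_on disk" "\<And>z. z \<in> disk \<Longrightarrow> g z = f z"
  shows "taylor_coeff g n = taylor_coeff f n"
  by (rule taylor_coeff_unique) (use assms taylor_coeff_sums in auto)

lemma taylor_coeff_lincomb:
  assumes "f holomorphic_on disk" "g holomorphic_on disk"
  shows "taylor_coeff (\<lambda>z. a * f z + b * g z) n = a * taylor_coeff f n + b * taylor_coeff g n"
proof (rule taylor_coeff_unique)
  fix z :: complex assume z: "z \<in> disk"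
  have "(\<lambda>n. a * (taylor_coeff f n * z ^ n) + b * (taylor_coeff g n * z ^ n)) sums (a * f z + b * g z)"
    by (intro sums_add sums_mult taylor_coeff_sums assms z)
  then show "(\<lambda>n. (a * taylor_coeff f n + b * taylor_coeff g n) * z ^ n) sums (a * f z + b * g z)"
    by (simp add: algebra_simps)
qed

lemma taylor_coeff_shift:
  assumes "f holomorphic_on disk"
  shows "taylor_coeff (\<lambda>z. z * f z) n = (if n = 0 then 0 else taylor_coeff f (n - 1))"
proof (rule taylor_coeff_unique)
  fix z :: complex assume z: "z \<in> disk"
  have "(\<lambda>n. z * (taylor_coeff f n * z ^ n)) sums (z * f z)"
    by (intro sums_mult taylor_coeff_sums assms z)
  then have "(\<lambda>n. (if Suc n = 0 then 0 else taylor_coeff f (Suc n - 1)) * z ^ Suc n) sums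
      (z * f z - (if (0::nat) = 0 then 0 else taylor_coeff f (0 - 1)) * z ^ 0)"
    by (simp add: algebra_simps)
  then show "(\<lambda>n. (if n = 0 then 0 else taylor_coeff f (n - 1)) * z ^ n) sums (z * f z)"
    by (subst (asm) sums_Suc_iff) simp
qed

lemma taylor_coeff_const: "taylor_coeff (\<lambda>z. c) n = (if n = 0 then c else 0)"
proof (rule taylor_coeff_unique)
  fix z :: complex
  show "(\<lambda>n. (if n = 0 then c else 0) * z ^ n) sums c"
    using sums_If_finite[of "\<lambda>n. n = 0" "\<lambda>n. c * z ^ n"] by (simp add: if_distrib if_distribR cong: if_cong)
qed

lemma taylor_coeff_0 [simp]: "taylor_coeff f 0 = f 0"
  by (simp add: taylor_coeff_def)

lemma taylor_coeff_monom: "taylor_coeff (\<lambda>z. z ^ k) n = (if n = k then 1 else 0)"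
proof (induction k arbitrary: n)
  case 0
  then show ?case using taylor_coeff_const[of 1] by simp
next
  case (Suc k)
  have "taylor_coeff (\<lambda>z. z * z ^ k) n = (if n = 0 then 0 else taylor_coeff (\<lambda>z. z ^ k) (n - 1))"
    by (rule taylor_coeff_shift) (intro holomorphic_intros)
  with Suc show ?case by (cases n) auto
qed

lemma holomorphic_backward_shift:
  assumes "f holomorphic_on disk"
  obtains g where "g holomorphic_on disk" "\<And>z. z \<in> disk \<Longrightarrow> f z = f 0 + z * g z"
proof -
  define g where "g = (\<lambda>z. if z = 0 then deriv f 0 else (f z - f 0) / z)"
  have "f field_differentiable at 0"
    using holomorphic_on_imp_differentiable_at[OF assms, of 0] by simp
  then have "deriv (\<lambda>z. f z - f 0) 0 = deriv f 0"
    by simp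
  moreover have "(\<lambda>z. f z - f 0) holomorphic_on disk"
    by (intro holomorphic_intros assms)
  ultimately have "g holomorphic_on disk"
    using pole_theorem_open_0[of "\<lambda>z. f z - f 0" disk 0 g] by (simp add: g_def)
  moreover have "f z = f 0 + z * g z" for z
    by (simp add: g_def)
  ultimately show ?thesis by (rule that)
qed

section \<open>The Hilbert space structure of the Hardy space\<close>

text \<open>
  The absolute value makes the norm nonnegative even where the series diverges, so that the simplifier
  can use its sign everywhere.
\<close>
definition h2norm :: "(complex \<Rightarrow> complex) \<Rightarrow> real" where
  "h2norm f = sqrt \<bar>\<Sum>n. (cmod (taylor_coeff f n))\<^sup>2\<bar>"

lemma h2norm_nonneg [simp]: "0 \<le> h2norm f"
  by (simp add: h2norm_def)

lemma hardy2_holomorphic: "f \<in> hardy2 \<Longrightarrow> f holomorphic_on disk"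
  by (simp add: hardy2_def)

lemma hardy2_summable: "f \<in> hardy2 \<Longrightarrow> summable (\<lambda>n. (cmod (taylor_coeff f n))\<^sup>2)"
  by (simp add: hardy2_def)

lemma h2norm_sums:
  assumes "f \<in> hardy2"
  shows "(\<lambda>n. (cmod (taylor_coeff f n))\<^sup>2) sums (h2norm f)\<^sup>2"
  using summable_sums[OF hardy2_summable[OF assms]]
  by (simp add: h2norm_def suminf_nonneg hardy2_summable[OF assms])

lemma hardy2_cong:
  assumes "f \<in> hardy2" "\<And>z. z \<in> disk \<Longrightarrow> g z = f z"
  shows "g \<in> hardy2"
proof -
  have "g holomorphic_on disk"
    by (rule holomorphic_transform[OF hardy2_holomorphic[OF assms(1)]]) (use assms(2) in auto)
  with assms show ?thesis
    using taylor_coeff_cong[OF hardy2_holomorphic[OF assms(1)] assms(2)] by (simp add: hardy2_def)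
qed

lemma hardy2_lincomb:
  assumes "f \<in> hardy2" "g \<in> hardy2"
  shows "(\<lambda>z. a * f z + b * g z) \<in> hardy2"
proof -
  note h = hardy2_holomorphic[OF assms(1)] hardy2_holomorphic[OF assms(2)]
  have "summable (\<lambda>n. 2 * ((cmod a)\<^sup>2 * (cmod (taylor_coeff f n))\<^sup>2 + (cmod b)\<^sup>2 * (cmod (taylor_coeff g n))\<^sup>2))"
    by (intro summable_add summable_mult hardy2_summable assms)
  moreover have "(cmod (a * x + b * y))\<^sup>2 \<le> 2 * ((cmod a)\<^sup>2 * (cmod x)\<^sup>2 + (cmod b)\<^sup>2 * (cmod y)\<^sup>2)" for x y
  proof -
    have "(cmod (a * x + b * y))\<^sup>2 \<le> (cmod a * cmod x + cmod b * cmod y)\<^sup>2"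
      by (intro power_mono) (metis norm_mult norm_triangle_ineq, simp)
    also have "\<dots> \<le> 2 * ((cmod a)\<^sup>2 * (cmod x)\<^sup>2 + (cmod b)\<^sup>2 * (cmod y)\<^sup>2)"
      using sum_squares_bound[of "cmod a * cmod x" "cmod b * cmod y"]
      by (simp add: power2_sum power_mult_distrib)
    finally show ?thesis .
  qed
  ultimately have "summable (\<lambda>n. (cmod (a * taylor_coeff f n + b * taylor_coeff g n))\<^sup>2)"
    by (intro summable_comparison_test'[where N = 0, OF \<open>summable _\<close>]) simp
  moreover have "(\<lambda>z. a * f z + b * g z) holomorphic_on disk"
    by (intro holomorphic_intros h)
  ultimately show ?thesis
    by (simp add: hardy2_def taylor_coeff_lincomb[OF h])
qed

lemma hardy2_const [simp]: "(\<lambda>z. c) \<in> hardy2"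
proof -
  have "(\<lambda>n. (cmod (taylor_coeff (\<lambda>z. c) n))\<^sup>2) = (\<lambda>n. if n = 0 then (cmod c)\<^sup>2 else 0)"
    by (auto simp: taylor_coeff_const)
  then show ?thesis by (simp add: hardy2_def)
qed

lemma hardy2_cmult: "f \<in> hardy2 \<Longrightarrow> (\<lambda>z. c * f z) \<in> hardy2"
  using hardy2_lincomb[of f f c 0] by simp

lemma hardy2_add: "f \<in> hardy2 \<Longrightarrow> g \<in> hardy2 \<Longrightarrow> (\<lambda>z. f z + g z) \<in> hardy2"
  using hardy2_lincomb[of f g 1 1] by simp

lemma hardy2_diff: "f \<in> hardy2 \<Longrightarrow> g \<in> hardy2 \<Longrightarrow> (\<lambda>z. f z - g z) \<in> hardy2"
  using hardy2_lincomb[of f g 1 "-1"] by simp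

lemma hardy2_sum: "(\<And>i. i \<in> A \<Longrightarrow> f i \<in> hardy2) \<Longrightarrow> (\<lambda>z. \<Sum>i\<in>A. f i z) \<in> hardy2"
  by (induction A rule: infinite_finite_induct) (auto intro: hardy2_add)

lemma hardy2_shift_iff:
  assumes "f holomorphic_on disk"
  shows "(\<lambda>z. z * f z) \<in> hardy2 \<longleftrightarrow> f \<in> hardy2"
proof -
  have "summable (\<lambda>n. (cmod (if n = 0 then 0 else taylor_coeff f (n - 1)))\<^sup>2) \<longleftrightarrow>
      summable (\<lambda>n. (cmod (taylor_coeff f n))\<^sup>2)"
    by (subst summable_Suc_iff[symmetric]) simp
  with assms show ?thesis
    by (auto simp: hardy2_def taylor_coeff_shift intro!: holomorphic_intros)
qed

lemma hardy2_shift: "f \<in> hardy2 \<Longrightarrow> (\<lambda>z. z * f z) \<in> hardy2"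
  by (simp add: hardy2_shift_iff hardy2_holomorphic)

lemma hardy2_shift_power: "f \<in> hardy2 \<Longrightarrow> (\<lambda>z. z ^ n * f z) \<in> hardy2"
proof (induction n)
  case (Suc n)
  from hardy2_shift[OF Suc.IH[OF Suc.prems]] show ?case by (simp add: mult.assoc)
qed simp

lemma hardy2_monom [simp]: "(\<lambda>z. z ^ n) \<in> hardy2"
  using hardy2_shift_power[of "\<lambda>_. 1" n] by simp

lemma hardy2_backward_shift:
  assumes "f \<in> hardy2"
  obtains g where "g \<in> hardy2" "\<And>z. z \<in> disk \<Longrightarrow> f z = f 0 + z * g z"
proof -
  obtain g where g: "g holomorphic_on disk" "\<And>z. z \<in> disk \<Longrightarrow> f z = f 0 + z * g z"
    using holomorphic_backward_shift[OF hardy2_holomorphic[OF assms]] by blast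
  have "(\<lambda>z. z * g z) \<in> hardy2"
    by (rule hardy2_cong[OF hardy2_diff[OF assms hardy2_const[of "f 0"]]]) (metis g(2) add_diff_cancel_left')
  then have "g \<in> hardy2" using hardy2_shift_iff[OF g(1)] by blast
  then show ?thesis using g(2) by (rule that)
qed

lemma hardy2_inner_bounds:
  assumes "f \<in> hardy2" "g \<in> hardy2"
  shows "summable (\<lambda>n. taylor_coeff f n * cnj (taylor_coeff g n))"
    and "cmod (hardy2_inner f g) \<le> h2norm f * h2norm g"
proof -
  let ?a = "\<lambda>n. cmod (taylor_coeff f n)" and ?b = "\<lambda>n. cmod (taylor_coeff g n)"
  have bd: "(\<Sum>n<N. ?a n * ?b n) \<le> h2norm f * h2norm g" for N
  proof -
    have le: "L2_set (\<lambda>n. cmod (taylor_coeff h n)) {..<N} \<le> h2norm h" if "h \<in> hardy2" for h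
    proof -
      have "(\<Sum>n<N. (cmod (taylor_coeff h n))\<^sup>2) \<le> (\<Sum>n. (cmod (taylor_coeff h n))\<^sup>2)"
        by (intro sum_le_suminf hardy2_summable that) auto
      then show ?thesis
        by (simp add: L2_set_def h2norm_def)
    qed
    have "(\<Sum>n<N. ?a n * ?b n) \<le> L2_set ?a {..<N} * L2_set ?b {..<N}"
      using L2_set_mult_ineq[of ?a ?b "{..<N}"] by simp
    also have "\<dots> \<le> h2norm f * h2norm g"
      by (intro mult_mono le assms) (auto simp: L2_set_nonneg)
    finally show ?thesis .
  qed
  have eq: "cmod (taylor_coeff f n * cnj (taylor_coeff g n)) = ?a n * ?b n" for n
    by (simp add: norm_mult)
  have sn: "summable (\<lambda>n. cmod (taylor_coeff f n * cnj (taylor_coeff g n)))"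
    unfolding eq
  proof (rule bounded_imp_summable[where B = "h2norm f * h2norm g"])
    show "(\<Sum>k\<le>n. ?a k * ?b k) \<le> h2norm f * h2norm g" for n
      using bd[of "Suc n"] unfolding lessThan_Suc_atMost .
  qed simp
  then show "summable (\<lambda>n. taylor_coeff f n * cnj (taylor_coeff g n))"
    by (rule summable_norm_cancel)
  have "cmod (hardy2_inner f g) \<le> (\<Sum>n. cmod (taylor_coeff f n * cnj (taylor_coeff g n)))"
    unfolding hardy2_inner_def by (rule summable_norm[OF sn])
  also have "\<dots> \<le> h2norm f * h2norm g"
    by (rule suminf_le_const[OF sn]) (use bd in \<open>simp add: eq\<close>)
  finally show "cmod (hardy2_inner f g) \<le> h2norm f * h2norm g" .
qed

lemma hardy2_inner_lincomb_left:
  assumes "f \<in> hardy2" "g \<in> hardy2" "h \<in> hardy2"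
  shows "hardy2_inner (\<lambda>z. a * f z + b * g z) h = a * hardy2_inner f h + b * hardy2_inner g h"
proof -
  have "(\<lambda>n. a * (taylor_coeff f n * cnj (taylor_coeff h n)) + b * (taylor_coeff g n * cnj (taylor_coeff h n)))
     sums (a * hardy2_inner f h + b * hardy2_inner g h)"
    unfolding hardy2_inner_def
    by (intro sums_add sums_mult summable_sums hardy2_inner_bounds assms)
  moreover have "taylor_coeff (\<lambda>z. a * f z + b * g z) n * cnj (taylor_coeff h n) =
      a * (taylor_coeff f n * cnj (taylor_coeff h n)) + b * (taylor_coeff g n * cnj (taylor_coeff h n))" for n
    by (simp add: taylor_coeff_lincomb hardy2_holomorphic assms algebra_simps)
  ultimately show ?thesis
    by (simp add: hardy2_inner_def sums_iff)
qed

lemma hardy2_inner_cnj: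
  "f \<in> hardy2 \<Longrightarrow> g \<in> hardy2 \<Longrightarrow> hardy2_inner g f = cnj (hardy2_inner f g)"
  using sums_cnj[THEN iffD2, OF summable_sums[OF hardy2_inner_bounds(1)], of f g]
  by (simp add: hardy2_inner_def sums_iff mult.commute)

lemma hardy2_inner_lincomb_right:
  assumes "f \<in> hardy2" "g \<in> hardy2" "h \<in> hardy2"
  shows "hardy2_inner h (\<lambda>z. a * f z + b * g z) = cnj a * hardy2_inner h f + cnj b * hardy2_inner h g"
  using hardy2_inner_cnj[of "\<lambda>z. a * f z + b * g z" h] hardy2_inner_lincomb_left[OF assms, of a b]
    hardy2_inner_cnj[of f h] hardy2_inner_cnj[of g h] assms by (simp add: hardy2_lincomb)

lemma hardy2_inner_cong_left:
  assumes "f holomorphic_on disk" "\<And>z. z \<in> disk \<Longrightarrow> g z = f z"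
  shows "hardy2_inner g h = hardy2_inner f h"
  using taylor_coeff_cong[OF assms] by (simp add: hardy2_inner_def)

lemma hardy2_inner_cong_right:
  assumes "f holomorphic_on disk" "\<And>z. z \<in> disk \<Longrightarrow> g z = f z"
  shows "hardy2_inner h g = hardy2_inner h f"
  using taylor_coeff_cong[OF assms] by (simp add: hardy2_inner_def)

lemma hardy2_inner_self: "f \<in> hardy2 \<Longrightarrow> hardy2_inner f f = of_real ((h2norm f)\<^sup>2)"
  using sums_of_real[OF h2norm_sums, of f, where ?'a = complex]
  by (simp add: hardy2_inner_def sums_iff complex_norm_square[symmetric] del: of_real_power add: of_real_power[symmetric])

lemma hardy2_inner_const_right: "hardy2_inner f (\<lambda>z. c) = f 0 * cnj c"
proof -
  have "(\<lambda>n. taylor_coeff f n * cnj (taylor_coeff (\<lambda>z. c) n)) = (\<lambda>n. if n = 0 then f 0 * cnj c else 0)"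
    by (auto simp: taylor_coeff_const)
  then show ?thesis
    using sums_single[of 0 "\<lambda>_. f 0 * cnj c"] by (simp add: hardy2_inner_def sums_iff)
qed

lemma hardy2_inner_shift:
  assumes "f \<in> hardy2" "g \<in> hardy2"
  shows "hardy2_inner (\<lambda>z. z * f z) (\<lambda>z. z * g z) = hardy2_inner f g"
proof -
  have "summable (\<lambda>n. taylor_coeff (\<lambda>z. z * f z) n * cnj (taylor_coeff (\<lambda>z. z * g z) n))"
    by (intro hardy2_inner_bounds hardy2_shift assms)
  from suminf_split_head[OF this] show ?thesis
    by (simp add: hardy2_inner_def taylor_coeff_shift hardy2_holomorphic assms)
qed

lemma h2norm_lincomb_sq:
  assumes "f \<in> hardy2" "g \<in> hardy2"
  shows "(h2norm (\<lambda>z. f z + c * g z))\<^sup>2 =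
    (h2norm f)\<^sup>2 + 2 * Re (cnj c * hardy2_inner f g) + (cmod c)\<^sup>2 * (h2norm g)\<^sup>2"
proof -
  let ?F = "\<lambda>z. 1 * f z + c * g z"
  have F: "?F \<in> hardy2" using hardy2_lincomb[OF assms, of 1 c] .
  define p where "p = hardy2_inner f g"
  have "of_real ((h2norm ?F)\<^sup>2) = hardy2_inner ?F ?F"
    using hardy2_inner_self[OF F] by simp
  also have "\<dots> = 1 * hardy2_inner f ?F + c * hardy2_inner g ?F"
    by (rule hardy2_inner_lincomb_left[OF assms F])
  also have "\<dots> = of_real ((h2norm f)\<^sup>2) + cnj c * p + c * (cnj p + cnj c * of_real ((h2norm g)\<^sup>2))"
    unfolding hardy2_inner_lincomb_right[OF assms assms(1)] hardy2_inner_lincomb_right[OF assms assms(2)]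
    using hardy2_inner_cnj[OF assms] hardy2_inner_self[OF assms(1)] hardy2_inner_self[OF assms(2)]
    by (simp add: p_def)
  also have "\<dots> = of_real ((h2norm f)\<^sup>2) + (cnj c * p + cnj (cnj c * p)) + c * cnj c * of_real ((h2norm g)\<^sup>2)"
    by (simp add: algebra_simps)
  also have "\<dots> = of_real ((h2norm f)\<^sup>2 + 2 * Re (cnj c * p) + (cmod c)\<^sup>2 * (h2norm g)\<^sup>2)"
    unfolding complex_add_cnj complex_norm_square[symmetric] by simp
  finally show ?thesis unfolding of_real_eq_iff p_def by simp
qed

lemma h2norm_triangle:
  assumes "f \<in> hardy2" "g \<in> hardy2"
  shows "h2norm (\<lambda>z. f z + g z) \<le> h2norm f + h2norm g"
proof (rule power2_le_imp_le)
  have "Re (hardy2_inner f g) \<le> h2norm f * h2norm g"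
    using complex_Re_le_cmod hardy2_inner_bounds(2)[OF assms] by (rule order_trans)
  then show "(h2norm (\<lambda>z. f z + g z))\<^sup>2 \<le> (h2norm f + h2norm g)\<^sup>2"
    using h2norm_lincomb_sq[OF assms, of 1] by (simp add: power2_sum)
qed simp

lemma h2norm_cmult:
  assumes "f \<in> hardy2"
  shows "h2norm (\<lambda>z. c * f z) = cmod c * h2norm f"
proof (rule power2_eq_imp_eq)
  have "(h2norm (\<lambda>z. 0 + c * f z))\<^sup>2 = (h2norm (\<lambda>z. 0))\<^sup>2 + (cmod c)\<^sup>2 * (h2norm f)\<^sup>2"
    using hardy2_inner_cnj[of f "\<lambda>_. 0"] assms
    by (subst h2norm_lincomb_sq) (auto simp: hardy2_inner_const_right)
  then show "(h2norm (\<lambda>z. c * f z))\<^sup>2 = (cmod c * h2norm f)\<^sup>2"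
    by (simp add: power_mult_distrib h2norm_def taylor_coeff_const)
qed auto

lemma h2norm_minus_commute:
  assumes "f \<in> hardy2" "g \<in> hardy2"
  shows "h2norm (\<lambda>z. f z - g z) = h2norm (\<lambda>z. g z - f z)"
  using h2norm_cmult[OF hardy2_diff[OF assms], of "-1"] by simp

lemma hardy2_coeff_le:
  assumes "f \<in> hardy2"
  shows "cmod (taylor_coeff f n) \<le> h2norm f"
proof (rule power2_le_imp_le)
  have "(\<Sum>k\<in>{n}. (cmod (taylor_coeff f k))\<^sup>2) \<le> (\<Sum>k. (cmod (taylor_coeff f k))\<^sup>2)"
    by (rule sum_le_suminf) (use hardy2_summable[OF assms] in auto)
  also have "\<dots> = (h2norm f)\<^sup>2"
    using h2norm_sums[OF assms] by (simp add: sums_iff)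
  finally show "(cmod (taylor_coeff f n))\<^sup>2 \<le> (h2norm f)\<^sup>2" by simp
qed simp

lemma taylor_coeff_sum:
  "(\<And>i. i \<in> A \<Longrightarrow> f i holomorphic_on disk) \<Longrightarrow>
    taylor_coeff (\<lambda>z. \<Sum>i\<in>A. f i z) n = (\<Sum>i\<in>A. taylor_coeff (f i) n)"
proof (induction A rule: infinite_finite_induct)
  case (insert x A)
  then have "taylor_coeff (\<lambda>z. 1 * f x z + 1 * (\<Sum>i\<in>A. f i z)) n = (\<Sum>i\<in>insert x A. taylor_coeff (f i) n)"
    by (subst taylor_coeff_lincomb) (auto intro!: holomorphic_intros)
  with insert.hyps show ?case by simp
qed (auto simp: taylor_coeff_const)

text \<open>
  Inner functions are first seen to act isometrically on polynomials, which are continuous on the closed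
  disk; this density carries the property to the whole space.
\<close>
lemma taylor_poly_tendsto:
  assumes "f \<in> hardy2"
  shows "(\<lambda>N. h2norm (\<lambda>z. f z - (\<Sum>n<N. taylor_coeff f n * z ^ n))) \<longlonglongrightarrow> 0"
proof -
  have mh: "(\<lambda>z. taylor_coeff f n * z ^ n) \<in> hardy2" for n
    by (intro hardy2_cmult) simp
  let ?s = "\<lambda>n. (cmod (taylor_coeff f n))\<^sup>2"
  have eq: "h2norm (\<lambda>z. f z - (\<Sum>n<N. taylor_coeff f n * z ^ n)) = sqrt (\<Sum>n. ?s (n + N))" for N
  proof -
    define p where "p = (\<lambda>z. \<Sum>k<N. taylor_coeff f k * z ^ k)"
    define R where "R = (\<lambda>z. f z - p z)"
    have p: "p \<in> hardy2" unfolding p_def by (intro hardy2_sum mh)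
    have c: "taylor_coeff R n = (if n < N then 0 else taylor_coeff f n)" for n
    proof -
      have "taylor_coeff p n = (\<Sum>k<N. taylor_coeff (\<lambda>z. taylor_coeff f k * z ^ k) n)"
        unfolding p_def by (rule taylor_coeff_sum) (intro holomorphic_intros)
      also have "\<dots> = (\<Sum>k<N. if k = n then taylor_coeff f k else 0)"
        using taylor_coeff_lincomb[of "\<lambda>z. z ^ k" "\<lambda>z. z ^ k" "taylor_coeff f k" 0 n for k]
        by (intro sum.cong) (auto simp: holomorphic_intros taylor_coeff_monom)
      also have "\<dots> = (if n < N then taylor_coeff f n else 0)"
        by simp
      finally show ?thesis
        using taylor_coeff_lincomb[of f p 1 "-1" n] assms p by (simp add: R_def hardy2_holomorphic)
    qed
    have R: "R \<in> hardy2" unfolding R_def by (intro hardy2_diff assms p)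
    have "(h2norm R)\<^sup>2 = (\<Sum>n. (cmod (taylor_coeff R n))\<^sup>2)"
      using h2norm_sums[OF R] by (simp add: sums_iff)
    also have "\<dots> = (\<Sum>n. (cmod (taylor_coeff R (n + N)))\<^sup>2)"
      by (subst suminf_split_initial_segment[OF hardy2_summable[OF R], of N]) (simp add: c)
    finally have "(h2norm R)\<^sup>2 = (\<Sum>n. ?s (n + N))" by (simp add: c)
    then show ?thesis
      unfolding R_def p_def by (metis h2norm_nonneg real_sqrt_unique)
  qed
  have "(\<lambda>N. \<Sum>n. ?s (n + N)) \<longlonglongrightarrow> 0"
    using suminf_exist_split2[OF hardy2_summable[OF assms]] by simp
  from tendsto_real_sqrt[OF this] show ?thesis unfolding eq by simp
qed

section \<open>Means over circles\<close>

text \<open>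
  Radial limits exist only almost everywhere, but every limit function below is continuous; so this
  form of dominated convergence is enough, and no integrability has to be checked when it is applied.
\<close>
lemma integral_tendsto_AE:
  fixes f :: "nat \<Rightarrow> real \<Rightarrow> real"
  assumes f: "\<And>k. continuous_on {a..b} (f k)" and g: "continuous_on {a..b} g"
    and bd: "\<And>k t. t \<in> {a..b} \<Longrightarrow> \<bar>f k t\<bar> \<le> M"
    and lim: "AE t in lebesgue_on {a..b}. (\<lambda>k. f k t) \<longlonglongrightarrow> g t"
  shows "(\<lambda>k. integral {a..b} (f k)) \<longlonglongrightarrow> integral {a..b} g"
proof -
  let ?L = "lebesgue_on {a..b}"
  have meas: "h \<in> borel_measurable ?L" if "continuous_on {a..b} h" for h :: "real \<Rightarrow> real"
    using that by (intro continuous_imp_measurable_on_sets_lebesgue) auto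
  have eq: "integral\<^sup>L ?L h = integral {a..b} h" if "continuous_on {a..b} h" for h :: "real \<Rightarrow> real"
    by (intro lebesgue_integral_eq_integral continuous_imp_integrable_real that) auto
  have "(\<lambda>k. integral\<^sup>L ?L (f k)) \<longlonglongrightarrow> integral\<^sup>L ?L g"
  proof (rule integral_dominated_convergence[where w = "\<lambda>_. M"])
    show "integrable ?L (\<lambda>_. M)"
      by (intro continuous_imp_integrable_real continuous_intros)
    show "AE t in ?L. norm (f k t) \<le> M" for k
      using bd by (intro AE_I2) auto
  qed (use meas f g lim in auto)
  then show ?thesis using eq f g by simp
qed

lemma integral_cis_int:
  "((\<lambda>t. cis (of_int k * t)) has_integral (if k = 0 then 2 * pi else 0)) {0..2 * pi}"
proof (cases "k = 0")
  case True
  then show ?thesis using has_integral_const_real[of "1::complex" 0 "2 * pi"] by (simp add: scaleR_conv_of_real)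
next
  case False
  have "((\<lambda>t. cis (of_int k * t)) has_integral
      (cis (of_int k * (2 * pi)) / (\<i> * of_int k) - cis (of_int k * 0) / (\<i> * of_int k))) {0..2 * pi}"
    using False
    by (intro fundamental_theorem_of_calculus)
       (auto simp: cis_conv_exp mult_ac intro!: derivative_eq_intros has_vector_derivative_real_field)
  moreover have "cis (of_int k * (2 * pi)) = 1"
    using cis_multiple_2pi[of "of_int k"] by (simp add: mult.commute)
  ultimately show ?thesis using False by simp
qed

definition circle_mean :: "(complex \<Rightarrow> complex) \<Rightarrow> real \<Rightarrow> real" where
  "circle_mean f r = integral {0..2 * pi} (\<lambda>t. (cmod (f (of_real r * cis t)))\<^sup>2) / (2 * pi)"

lemma trig_poly_integral:
  fixes c :: "nat \<Rightarrow> complex"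
  shows "integral {0..2 * pi} (\<lambda>t. (cmod (\<Sum>n<N. c n * cis (real n * t)))\<^sup>2) = 2 * pi * (\<Sum>n<N. (cmod (c n))\<^sup>2)"
proof -
  have eq: "of_real ((cmod (\<Sum>n<N. c n * cis (real n * t)))\<^sup>2) =
      (\<Sum>m<N. \<Sum>n<N. c m * cnj (c n) * cis (of_int (int m - int n) * t))" for t
    unfolding complex_norm_square
    by (simp add: sum_product cis_cnj cis_mult algebra_simps)
  have "((\<lambda>t. \<Sum>m<N. \<Sum>n<N. c m * cnj (c n) * cis (of_int (int m - int n) * t)) has_integral
      (\<Sum>m<N. \<Sum>n<N. c m * cnj (c n) * (if int m - int n = 0 then 2 * pi else 0))) {0..2 * pi}"
    by (intro has_integral_sum finite_lessThan has_integral_mult_right integral_cis_int)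
  also have "(\<Sum>m<N. \<Sum>n<N. c m * cnj (c n) * (if int m - int n = 0 then 2 * pi else 0)) =
      (\<Sum>m<N. \<Sum>n<N. if m = n then c m * cnj (c m) * (2 * pi) else 0)"
    by (intro sum.cong refl) auto
  also have "\<dots> = of_real (2 * pi * (\<Sum>n<N. (cmod (c n))\<^sup>2))"
    by (simp add: complex_norm_square sum_distrib_left mult_ac flip: of_real_power)
  finally have "((\<lambda>t. complex_of_real ((cmod (\<Sum>n<N. c n * cis (real n * t)))\<^sup>2)) has_integral
      of_real (2 * pi * (\<Sum>n<N. (cmod (c n))\<^sup>2))) {0..2 * pi}"
    unfolding eq .
  from has_integral_linear[OF this bounded_linear_Re] show ?thesis
    unfolding o_def Re_complex_of_real by (rule integral_unique)
qed

text \<open>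
  This is Parseval's identity on a circle inside the disk, obtained from the Taylor polynomials,
  which converge boundedly on that circle.
\<close>
lemma circle_mean_sums:
  assumes f: "f holomorphic_on disk" and r: "0 \<le> r" "r < 1"
  shows "(\<lambda>n. (cmod (taylor_coeff f n))\<^sup>2 * r ^ (2 * n)) sums circle_mean f r"
proof -
  define s where "s = (\<lambda>N t. \<Sum>n<N. taylor_coeff f n * of_real r ^ n * cis (real n * t))"
  have arg: "of_real r * cis t \<in> disk" for t
    using r by (simp add: norm_mult)
  have pw: "(of_real r * cis t) ^ n = of_real r ^ n * cis (real n * t)" for n t
    by (simp only: power_mult_distrib Complex.DeMoivre)
  have lim: "(\<lambda>N. s N t) \<longlonglongrightarrow> f (of_real r * cis t)" for t
    using taylor_coeff_sums[OF f arg, of t] by (simp add: sums_def s_def pw mult.assoc)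
  have sn: "summable (\<lambda>n. cmod (taylor_coeff f n) * r ^ n)"
  proof -
    define q where "q = (1 + r) / 2"
    have q: "r < q" "q < 1" using r by (auto simp: q_def)
    have "summable (\<lambda>n. taylor_coeff f n * of_real q ^ n)"
      using taylor_coeff_sums[OF f, of "of_real q"] q r by (auto simp: sums_iff)
    from powser_insidea[OF this, of "of_real r"] q r show ?thesis
      by (simp add: norm_mult norm_power)
  qed
  define M where "M = (\<Sum>n. cmod (taylor_coeff f n) * r ^ n)"
  have bd: "cmod (s N t) \<le> M" for N t
  proof -
    have "cmod (s N t) \<le> (\<Sum>n<N. cmod (taylor_coeff f n) * r ^ n)"
      unfolding s_def using r by (intro sum_norm_le) (simp add: norm_mult norm_power)
    also have "\<dots> \<le> M"
      unfolding M_def using r by (intro sum_le_suminf sn) auto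
    finally show ?thesis .
  qed
  have cont: "continuous_on {0..2 * pi} (\<lambda>t. f (of_real r * cis t))"
    by (rule continuous_on_compose2[OF holomorphic_on_imp_continuous_on[OF f]])
      (use arg in \<open>auto intro!: continuous_intros\<close>)
  have "(\<lambda>N. integral {0..2 * pi} (\<lambda>t. (cmod (s N t))\<^sup>2)) \<longlonglongrightarrow>
      integral {0..2 * pi} (\<lambda>t. (cmod (f (of_real r * cis t)))\<^sup>2)"
  proof (rule integral_tendsto_AE[where M = "M\<^sup>2"])
    show "continuous_on {0..2 * pi} (\<lambda>t. (cmod (s N t))\<^sup>2)" for N
      unfolding s_def by (intro continuous_intros)
    show "continuous_on {0..2 * pi} (\<lambda>t. (cmod (f (of_real r * cis t)))\<^sup>2)"
      by (intro continuous_intros cont)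
    show "\<bar>(cmod (s N t))\<^sup>2\<bar> \<le> M\<^sup>2" for N t
      using bd[of N t] by (simp add: power_mono)
    show "AE t in lebesgue_on {0..2 * pi}. (\<lambda>N. (cmod (s N t))\<^sup>2) \<longlonglongrightarrow> (cmod (f (of_real r * cis t)))\<^sup>2"
      by (intro AE_I2 tendsto_intros lim)
  qed
  moreover have "integral {0..2 * pi} (\<lambda>t. (cmod (s N t))\<^sup>2) =
      2 * pi * (\<Sum>n<N. (cmod (taylor_coeff f n))\<^sup>2 * r ^ (2 * n))" for N
    unfolding s_def trig_poly_integral using r
    by (simp add: norm_mult norm_power power_mult_distrib power_mult mult.commute[of 2] flip: power_mult)
  ultimately have "(\<lambda>N. 2 * pi * (\<Sum>n<N. (cmod (taylor_coeff f n))\<^sup>2 * r ^ (2 * n)) / (2 * pi)) \<longlonglongrightarrow> circle_mean f r"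
    unfolding circle_mean_def by (intro tendsto_divide) auto
  then show ?thesis by (simp add: sums_def)
qed

lemma circle_mean_le_h2norm:
  assumes "f \<in> hardy2" "0 \<le> r" "r < 1"
  shows "circle_mean f r \<le> (h2norm f)\<^sup>2"
proof (rule sums_le[OF _ circle_mean_sums[OF hardy2_holomorphic[OF assms(1)] assms(2,3)] h2norm_sums[OF assms(1)]])
  fix n
  have "r ^ (2 * n) \<le> 1" using assms by (intro power_le_one) auto
  then show "(cmod (taylor_coeff f n))\<^sup>2 * r ^ (2 * n) \<le> (cmod (taylor_coeff f n))\<^sup>2"
    by (intro mult_left_le) auto
qed

text \<open>
  Letting the radius tend to \<open>1\<close> in a fixed partial sum gives the bound for that partial sum, and
  membership in the Hardy space follows from the bound on all of them.
\<close>
lemma hardy2_if_circle_means_le: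
  assumes f: "f holomorphic_on disk"
    and r: "\<And>k. 0 \<le> r k" "\<And>k. r k < 1" "r \<longlonglongrightarrow> 1"
    and L: "m \<longlonglongrightarrow> L" "\<And>k. circle_mean f (r k) \<le> m k"
  shows "f \<in> hardy2" "(h2norm f)\<^sup>2 \<le> L"
proof -
  have le: "(\<Sum>n<N. (cmod (taylor_coeff f n))\<^sup>2) \<le> L" for N
  proof (rule LIMSEQ_le[OF _ L(1)])
    show "(\<lambda>k. \<Sum>n<N. (cmod (taylor_coeff f n))\<^sup>2 * r k ^ (2 * n)) \<longlonglongrightarrow> (\<Sum>n<N. (cmod (taylor_coeff f n))\<^sup>2)"
      by (rule tendsto_eq_intros refl r(3))+ simp
    have "(\<Sum>n<N. (cmod (taylor_coeff f n))\<^sup>2 * r k ^ (2 * n)) \<le> m k" for k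
    proof -
      note s = circle_mean_sums[OF f r(1,2), of k]
      have "(\<Sum>n<N. (cmod (taylor_coeff f n))\<^sup>2 * r k ^ (2 * n)) \<le> circle_mean f (r k)"
        using sum_le_suminf[OF sums_summable[OF s], of "{..<N}"] r(1) sums_unique[OF s] by simp
      then show ?thesis using L(2) order_trans by blast
    qed
    then show "\<exists>K. \<forall>k\<ge>K. (\<Sum>n<N. (cmod (taylor_coeff f n))\<^sup>2 * r k ^ (2 * n)) \<le> m k" by blast
  qed
  have le': "(\<Sum>n\<le>N. (cmod (taylor_coeff f n))\<^sup>2) \<le> L" for N
    using le[of "Suc N"] unfolding lessThan_Suc_atMost .
  have "summable (\<lambda>n. (cmod (taylor_coeff f n))\<^sup>2)"
    by (rule bounded_imp_summable[OF _ le']) simp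
  then show H: "f \<in> hardy2" using f by (simp add: hardy2_def)
  show "(h2norm f)\<^sup>2 \<le> L"
    using suminf_le_const[OF hardy2_summable[OF H] le] sums_unique[OF h2norm_sums[OF H]] by simp
qed

text \<open>
  A fixed sequence increasing to \<open>1\<close>, because dominated convergence is applied along sequences.
\<close>
definition radius :: "nat \<Rightarrow> real" where
  "radius k = 1 - 1 / real (k + 2)"

lemma radius: "0 < radius k" "0 \<le> radius k" "radius k < 1" "radius \<longlonglongrightarrow> 1"
proof -
  show "0 < radius k" "0 \<le> radius k" "radius k < 1" by (auto simp: radius_def field_simps)
  have "(\<lambda>k. 1 - 1 / real (k + 2)) \<longlonglongrightarrow> 1 - 0"
    by (intro tendsto_intros LIMSEQ_ignore_initial_segment lim_1_over_n)
  then show "radius \<longlonglongrightarrow> 1" by (simp add: radius_def [abs_def])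
qed

lemma continuous_on_circle:
  assumes "f holomorphic_on disk" "0 \<le> r" "r < 1"
  shows "continuous_on S (\<lambda>t. f (of_real r * cis t))"
  by (rule continuous_on_compose2[OF holomorphic_on_imp_continuous_on[OF assms(1)]])
    (use assms(2,3) in \<open>auto intro!: continuous_intros simp: norm_mult\<close>)

text \<open>
  Comparing means over circles turns pointwise domination in the disk into domination of norms. Two
  dominating functions are needed for the product of an element of each of two model spaces: near one part of the
  circle the first factor is bounded and near the rest the second is.
\<close>
lemma hardy2_dominated:
  assumes F: "F holomorphic_on disk" and AB: "A \<in> hardy2" "B \<in> hardy2" and c: "0 \<le> a" "0 \<le> b"
    and le: "\<And>z. z \<in> disk \<Longrightarrow> (cmod (F z))\<^sup>2 \<le> a * (cmod (A z))\<^sup>2 + b * (cmod (B z))\<^sup>2"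
  shows "F \<in> hardy2" "(h2norm F)\<^sup>2 \<le> a * (h2norm A)\<^sup>2 + b * (h2norm B)\<^sup>2"
proof -
  let ?L = "a * (h2norm A)\<^sup>2 + b * (h2norm B)\<^sup>2"
  have "circle_mean F r \<le> ?L" if r: "0 \<le> r" "r < 1" for r
  proof -
    note cont = continuous_on_circle[OF _ r]
    have int: "(\<lambda>t. (cmod (G (of_real r * cis t)))\<^sup>2) integrable_on {0..2 * pi}" if "G holomorphic_on disk" for G
      by (intro integrable_continuous_real continuous_intros cont that)
    note ints = int[OF F] int[OF hardy2_holomorphic[OF AB(1)]] int[OF hardy2_holomorphic[OF AB(2)]]
    have "integral {0..2 * pi} (\<lambda>t. (cmod (F (of_real r * cis t)))\<^sup>2) \<le>
       integral {0..2 * pi} (\<lambda>t. a * (cmod (A (of_real r * cis t)))\<^sup>2 + b * (cmod (B (of_real r * cis t)))\<^sup>2)"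
      by (intro integral_le integrable_add integrable_on_mult_right ints le)
        (use r in \<open>simp add: norm_mult\<close>)
    also have "\<dots> = a * integral {0..2 * pi} (\<lambda>t. (cmod (A (of_real r * cis t)))\<^sup>2)
        + b * integral {0..2 * pi} (\<lambda>t. (cmod (B (of_real r * cis t)))\<^sup>2)"
      by (simp add: integral_add integrable_on_mult_right ints)
    finally have "circle_mean F r \<le> a * circle_mean A r + b * circle_mean B r"
      by (simp add: circle_mean_def field_simps)
    also have "\<dots> \<le> ?L"
      using AB c r by (intro add_mono mult_left_mono circle_mean_le_h2norm) auto
    finally show ?thesis .
  qed
  then have "\<And>k. circle_mean F (radius k) \<le> ?L" using radius by blast
  from hardy2_if_circle_means_le[OF F radius(2,3,4) tendsto_const this]
  show "F \<in> hardy2" "(h2norm F)\<^sup>2 \<le> ?L" by auto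
qed

lemma hardy2_bounded_mult:
  assumes g: "g holomorphic_on disk" "\<And>z. z \<in> disk \<Longrightarrow> cmod (g z) \<le> M" and f: "f \<in> hardy2"
  shows "(\<lambda>z. g z * f z) \<in> hardy2" "h2norm (\<lambda>z. g z * f z) \<le> M * h2norm f"
proof -
  have M: "0 \<le> M" using order_trans[OF norm_ge_zero g(2)[of 0]] by simp
  have h: "(\<lambda>z. g z * f z) holomorphic_on disk"
    by (intro holomorphic_intros g hardy2_holomorphic f)
  have "(cmod (g z * f z))\<^sup>2 \<le> M\<^sup>2 * (cmod (f z))\<^sup>2 + 0 * (cmod (f z))\<^sup>2" if "z \<in> disk" for z
    using g(2)[OF that] by (simp add: norm_mult power_mult_distrib mult_right_mono power_mono)
  note * = hardy2_dominated[OF h f f _ _ this]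
  show "(\<lambda>z. g z * f z) \<in> hardy2" using * by simp
  show "h2norm (\<lambda>z. g z * f z) \<le> M * h2norm f"
    by (rule power2_le_imp_le) (use * M in \<open>simp_all add: power_mult_distrib\<close>)
qed

section \<open>Inner functions act isometrically\<close>

lemma inner_function_holomorphic: "inner_function u \<Longrightarrow> u holomorphic_on disk"
  by (simp add: inner_function_def)

lemma inner_function_hardy2_mult:
  assumes "inner_function u" "f \<in> hardy2"
  shows "(\<lambda>z. u z * f z) \<in> hardy2"
proof -
  from assms obtain M where "\<And>z. z \<in> disk \<Longrightarrow> cmod (u z) \<le> M"
    unfolding inner_function_def bounded_iff by blast
  from hardy2_bounded_mult(1)[OF inner_function_holomorphic[OF assms(1)] this assms(2)] show ?thesis .
qed

lemma inner_function_radial: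
  assumes "inner_function u"
  shows "AE t in lebesgue_on {0..2 * pi}. (\<lambda>k. cmod (u (of_real (radius k) * cis t))) \<longlonglongrightarrow> 1"
proof -
  have "filterlim radius (at_left 1) sequentially"
    unfolding filterlim_at using radius by (auto intro!: always_eventually) (metis order_less_irrefl)
  note rad = this
  have "AE t in lebesgue_on {0..2 * pi}. \<exists>l. ((\<lambda>r. u (of_real r * cis t)) \<longlongrightarrow> l) (at_left 1) \<and> cmod l = 1"
    using assms by (simp add: inner_function_def)
  then show ?thesis
  proof eventually_elim
    fix t assume "\<exists>l. ((\<lambda>r. u (of_real r * cis t)) \<longlongrightarrow> l) (at_left 1) \<and> cmod l = 1"
    then obtain l where "((\<lambda>r. u (of_real r * cis t)) \<longlongrightarrow> l) (at_left 1)" "cmod l = 1"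
      by blast
    from tendsto_norm[OF filterlim_compose[OF this(1) rad]] this(2)
    show "(\<lambda>k. cmod (u (of_real (radius k) * cis t))) \<longlonglongrightarrow> 1" by simp
  qed
qed

text \<open>
  The polynomial has boundary values everywhere and \<open>|u|\<close> tends to \<open>1\<close> along almost every radius, so
  the circle means converge to an integral that no longer contains \<open>u\<close>. Comparison with the constant
  inner function \<open>1\<close> then shows that \<open>u\<close> preserves the norm of a polynomial.
\<close>
lemma inner_function_h2norm_poly:
  fixes c :: "nat \<Rightarrow> complex" and N :: nat
  assumes u: "inner_function u"
  defines "p \<equiv> \<lambda>z. \<Sum>n<N. c n * z ^ n"
  shows "(h2norm (\<lambda>z. u z * p z))\<^sup>2 = integral {0..2 * pi} (\<lambda>t. (cmod (p (cis t)))\<^sup>2) / (2 * pi)"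
proof -
  have contp: "continuous_on S p" for S
    unfolding p_def by (intro continuous_intros)
  have p: "p \<in> hardy2"
    unfolding p_def by (intro hardy2_sum hardy2_cmult) simp
  have up: "(\<lambda>z. u z * p z) \<in> hardy2"
    by (rule inner_function_hardy2_mult[OF u p])
  from u obtain M where M: "\<And>z. z \<in> disk \<Longrightarrow> cmod (u z) \<le> M"
    unfolding inner_function_def bounded_iff by blast
  obtain K where K: "\<And>z. z \<in> cball 0 1 \<Longrightarrow> cmod (p z) \<le> K"
    using compact_imp_bounded[OF compact_continuous_image[OF contp compact_cball[of 0 1]]]
    unfolding bounded_iff by blast
  have "(\<lambda>k. integral {0..2 * pi} (\<lambda>t. (cmod (u (of_real (radius k) * cis t) * p (of_real (radius k) * cis t)))\<^sup>2))
      \<longlonglongrightarrow> integral {0..2 * pi} (\<lambda>t. (cmod (p (cis t)))\<^sup>2)"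
  proof (rule integral_tendsto_AE[where M = "(M * K)\<^sup>2"])
    fix k t
    have d: "of_real (radius k) * cis t \<in> disk" using radius(2,3)[of k] by (simp add: norm_mult)
    show "\<bar>(cmod (u (of_real (radius k) * cis t) * p (of_real (radius k) * cis t)))\<^sup>2\<bar> \<le> (M * K)\<^sup>2"
      using M[OF d] K[of "of_real (radius k) * cis t"] d order_trans[OF norm_ge_zero M[OF d]]
      by (simp add: norm_mult mult_mono power_mono)
  next
    show "AE t in lebesgue_on {0..2 * pi}. (\<lambda>k. (cmod (u (of_real (radius k) * cis t) * p (of_real (radius k) * cis t)))\<^sup>2)
        \<longlonglongrightarrow> (cmod (p (cis t)))\<^sup>2"
      using inner_function_radial[OF u]
    proof eventually_elim
      fix t assume l: "(\<lambda>k. cmod (u (of_real (radius k) * cis t))) \<longlonglongrightarrow> 1"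
      have "(\<lambda>k. p (of_real (radius k) * cis t)) \<longlonglongrightarrow> p (of_real 1 * cis t)"
        by (rule continuous_on_tendsto_compose[OF contp[of UNIV]]) (intro tendsto_intros radius(4), auto)
      then have "(\<lambda>k. (cmod (u (of_real (radius k) * cis t)) * cmod (p (of_real (radius k) * cis t)))\<^sup>2)
          \<longlonglongrightarrow> (1 * cmod (p (of_real 1 * cis t)))\<^sup>2"
        by (intro tendsto_intros l)
      then show "(\<lambda>k. (cmod (u (of_real (radius k) * cis t) * p (of_real (radius k) * cis t)))\<^sup>2)
          \<longlonglongrightarrow> (cmod (p (cis t)))\<^sup>2"
        by (simp add: norm_mult)
    qed
  qed (intro continuous_intros continuous_on_circle inner_function_holomorphic[OF u] hardy2_holomorphic[OF p]
      radius continuous_on_compose2[OF contp[of UNIV]] subset_UNIV)+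
  then have lim: "(\<lambda>k. circle_mean (\<lambda>z. u z * p z) (radius k)) \<longlonglongrightarrow> integral {0..2 * pi} (\<lambda>t. (cmod (p (cis t)))\<^sup>2) / (2 * pi)"
    unfolding circle_mean_def by (intro tendsto_divide) auto
  show ?thesis
  proof (rule antisym)
    show "(h2norm (\<lambda>z. u z * p z))\<^sup>2 \<le> integral {0..2 * pi} (\<lambda>t. (cmod (p (cis t)))\<^sup>2) / (2 * pi)"
      by (rule hardy2_if_circle_means_le[OF hardy2_holomorphic[OF up] radius(2,3,4) lim]) simp
    show "integral {0..2 * pi} (\<lambda>t. (cmod (p (cis t)))\<^sup>2) / (2 * pi) \<le> (h2norm (\<lambda>z. u z * p z))\<^sup>2"
      by (rule LIMSEQ_le_const2[OF lim]) (use circle_mean_le_h2norm[OF up radius(2,3)] in blast)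
  qed
qed

lemma inner_function_const:
  assumes "cmod c = 1"
  shows "inner_function (\<lambda>z. c)"
proof -
  have "bounded ((\<lambda>z. c) ` disk)"
    by (rule bounded_subset[of "{c}"]) auto
  moreover have "\<exists>l. ((\<lambda>r. c) \<longlongrightarrow> l) (at_left (1::real)) \<and> cmod l = 1"
    using assms by (intro exI[of _ c]) simp
  ultimately show ?thesis
    unfolding inner_function_def by simp
qed

lemma inner_function_h2norm:
  assumes u: "inner_function u" and f: "f \<in> hardy2"
  shows "h2norm (\<lambda>z. u z * f z) = h2norm f"
proof -
  define p where "p = (\<lambda>N z. \<Sum>n<N. taylor_coeff f n * z ^ n)"
  have p: "p N \<in> hardy2" for N
    unfolding p_def by (intro hardy2_sum hardy2_cmult) simp
  from u obtain M where M: "\<And>z. z \<in> disk \<Longrightarrow> cmod (u z) \<le> M"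
    unfolding inner_function_def bounded_iff by blast
  have iso: "h2norm (\<lambda>z. u z * p N z) = h2norm (p N)" for N
    by (rule power2_eq_imp_eq)
      (use inner_function_h2norm_poly[OF u] inner_function_h2norm_poly[OF inner_function_const[of 1]] in \<open>simp_all add: p_def\<close>)
  have tri: "\<bar>h2norm g - h2norm h\<bar> \<le> h2norm (\<lambda>z. g z - h z)" if "g \<in> hardy2" "h \<in> hardy2" for g h
    using h2norm_triangle[OF hardy2_diff[OF that] that(2)] h2norm_triangle[OF hardy2_diff[OF that(2,1)] that(1)]
      h2norm_minus_commute[OF that] by simp
  note uf = inner_function_hardy2_mult[OF u]
  have bd: "\<bar>h2norm (\<lambda>z. u z * f z) - h2norm f\<bar> \<le> (M + 1) * h2norm (\<lambda>z. f z - p N z)" for N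
  proof -
    have "h2norm (\<lambda>z. u z * f z - u z * p N z) = h2norm (\<lambda>z. u z * (f z - p N z))"
      by (simp add: algebra_simps)
    also have "\<dots> \<le> M * h2norm (\<lambda>z. f z - p N z)"
      by (intro hardy2_bounded_mult(2) inner_function_holomorphic u M hardy2_diff f p)
    finally show ?thesis
      using tri[OF uf[OF f] uf[OF p[of N]]] tri[OF f p[of N]] iso[of N] by (simp add: algebra_simps)
  qed
  have "(\<lambda>N. (M + 1) * h2norm (\<lambda>z. f z - p N z)) \<longlonglongrightarrow> (M + 1) * 0"
    unfolding p_def by (intro tendsto_intros taylor_poly_tendsto f)
  from LIMSEQ_le_const[OF this, of "\<bar>h2norm (\<lambda>z. u z * f z) - h2norm f\<bar>"] bd show ?thesis by auto
qed

text \<open>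
  Polarisation: the norms of \<open>u (f + c g)\<close> and \<open>f + c g\<close> agree, and \<open>c = 1\<close> and \<open>c = \<i>\<close> recover the real
  and the imaginary part of the inner product.
\<close>
lemma inner_function_inner:
  assumes u: "inner_function u" and f: "f \<in> hardy2" and g: "g \<in> hardy2"
  shows "hardy2_inner (\<lambda>z. u z * f z) (\<lambda>z. u z * g z) = hardy2_inner f g"
proof -
  note uf = inner_function_hardy2_mult[OF u f] and ug = inner_function_hardy2_mult[OF u g]
  have "Re (cnj c * hardy2_inner (\<lambda>z. u z * f z) (\<lambda>z. u z * g z)) = Re (cnj c * hardy2_inner f g)" for c
  proof -
    have "h2norm (\<lambda>z. u z * (f z + c * g z)) = h2norm (\<lambda>z. f z + c * g z)"
      by (intro inner_function_h2norm u hardy2_add hardy2_cmult f g)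
    then have "(h2norm (\<lambda>z. u z * f z + c * (u z * g z)))\<^sup>2 = (h2norm (\<lambda>z. f z + c * g z))\<^sup>2"
      by (simp add: algebra_simps)
    then show ?thesis
      unfolding h2norm_lincomb_sq[OF uf ug] h2norm_lincomb_sq[OF f g]
        inner_function_h2norm[OF u f] inner_function_h2norm[OF u g] by simp
  qed
  from this[of 1] this[of \<i>] show ?thesis by (simp add: complex_eq_iff)
qed

section \<open>Reproducing kernels\<close>

text \<open>
  The kernel of evaluation at \<open>w\<close>.
\<close>
definition szego :: "complex \<Rightarrow> complex \<Rightarrow> complex" where
  "szego w z = 1 / (1 - cnj w * z)"

lemma szego_denominator_bound:
  assumes "w \<in> disk" "z \<in> disk"
  shows "1 - cmod w \<le> cmod (1 - cnj w * z)" "1 - cnj w * z \<noteq> 0"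
proof -
  have "cmod (cnj w * z) \<le> cmod w"
    using assms by (simp add: norm_mult mult_left_le)
  then show "1 - cmod w \<le> cmod (1 - cnj w * z)"
    using norm_triangle_ineq2[of 1 "cnj w * z"] by simp
  then show "1 - cnj w * z \<noteq> 0" using assms by auto
qed

lemma szego_taylor:
  assumes "w \<in> disk"
  shows "szego w holomorphic_on disk" "taylor_coeff (szego w) n = cnj w ^ n"
proof -
  have s: "(\<lambda>n. cnj w ^ n * z ^ n) sums szego w z" if "z \<in> disk" for z
  proof -
    have "cmod w * cmod z < 1"
      using assms that mult_strict_mono[of "cmod w" 1 "cmod z" 1] by simp
    then have "cmod (cnj w * z) < 1" by (simp add: norm_mult)
    from geometric_sums[OF this] show ?thesis by (simp add: szego_def power_mult_distrib)
  qed
  from taylor_coeff_unique[OF s] show "szego w holomorphic_on disk" "taylor_coeff (szego w) n = cnj w ^ n"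
    by auto
qed

lemma szego_h2norm_sums:
  assumes "w \<in> disk"
  shows "(\<lambda>n. (cmod (taylor_coeff (szego w) n))\<^sup>2) sums (1 / (1 - (cmod w)\<^sup>2))"
proof -
  have "(cmod w)\<^sup>2 < 1" using assms by (simp add: power_less_one_iff abs_square_less_1)
  then show ?thesis
    using geometric_sums[of "(cmod w)\<^sup>2"] assms
    by (simp add: szego_taylor norm_power mult.commute flip: power_mult)
qed

lemma szego_hardy2: "w \<in> disk \<Longrightarrow> szego w \<in> hardy2"
  using sums_summable[OF szego_h2norm_sums] by (simp add: hardy2_def szego_taylor)

lemma szego_reproducing:
  assumes "f \<in> hardy2" "w \<in> disk"
  shows "hardy2_inner f (szego w) = f w"
  using taylor_coeff_sums[OF hardy2_holomorphic[OF assms(1)] assms(2)]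
  by (simp add: hardy2_inner_def szego_taylor(2)[OF assms(2)] sums_iff)

text \<open>
  All powers of an inner function have norm \<open>1\<close>, whereas evaluation at a point of the disk is a
  bounded functional; so no value can exceed \<open>1\<close> in modulus.
\<close>
lemma inner_function_le_one:
  assumes u: "inner_function u" and w: "w \<in> disk"
  shows "cmod (u w) \<le> 1"
proof (rule ccontr)
  have pow: "(\<lambda>z. u z ^ n) \<in> hardy2 \<and> h2norm (\<lambda>z. u z ^ n) = 1" for n
  proof (induction n)
    case 0
    have "(h2norm (\<lambda>z. 1))\<^sup>2 = 1"
      using hardy2_inner_self[of "\<lambda>z. 1"] by (simp add: hardy2_inner_const_right flip: of_real_power)
    then show ?case by (simp add: power2_eq_1_iff) (smt (verit) h2norm_nonneg)
  next
    case (Suc n)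
    then show ?case
      using inner_function_hardy2_mult[OF u, of "\<lambda>z. u z ^ n"] inner_function_h2norm[OF u, of "\<lambda>z. u z ^ n"] by simp
  qed
  assume "\<not> cmod (u w) \<le> 1"
  then obtain n where "h2norm (szego w) < cmod (u w) ^ n"
    using real_arch_pow[of "cmod (u w)"] by auto
  moreover have "cmod (u w ^ n) \<le> h2norm (\<lambda>z. u z ^ n) * h2norm (szego w)"
    using hardy2_inner_bounds(2)[of "\<lambda>z. u z ^ n" "szego w"] szego_reproducing[of "\<lambda>z. u z ^ n" w]
      pow[of n] szego_hardy2[OF w] w by simp
  ultimately show False using pow[of n] by (simp add: norm_power)
qed

lemma inner_function_less_one:
  assumes u: "inner_function u" and nc: "\<not> u constant_on disk" and w: "w \<in> disk"
  shows "cmod (u w) < 1"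
proof (rule ccontr)
  assume "\<not> cmod (u w) < 1"
  then have "cmod (u z) \<le> cmod (u w)" if "z \<in> disk" for z
    using inner_function_le_one[OF u that] by simp
  then have "u constant_on disk"
    by (intro maximum_modulus_principle[OF inner_function_holomorphic[OF u] _ _ open_ball _ w]) auto
  with nc show False by simp
qed

section \<open>Model spaces\<close>

lemma model_space_iff:
  "f \<in> model_space \<Theta> \<longleftrightarrow> f \<in> hardy2 \<and> (\<forall>h\<in>hardy2. hardy2_inner f (\<lambda>z. \<Theta> z * h z) = 0)"
  by (auto simp: model_space_def hardy2_orthogonal_def)

lemma model_space_hardy2: "f \<in> model_space \<Theta> \<Longrightarrow> f \<in> hardy2"
  by (simp add: model_space_iff)

lemma model_space_cong:
  assumes "\<And>h. h \<in> hardy2 \<Longrightarrow> (\<lambda>z. \<Theta> z * h z) \<in> hardy2" "\<And>z. z \<in> disk \<Longrightarrow> \<Psi> z = \<Theta> z"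
  shows "model_space \<Psi> = model_space \<Theta>"
proof -
  have "hardy2_inner f (\<lambda>z. \<Psi> z * h z) = hardy2_inner f (\<lambda>z. \<Theta> z * h z)" if "h \<in> hardy2" for f h
    by (rule hardy2_inner_cong_right[OF hardy2_holomorphic[OF assms(1)[OF that]]]) (use assms(2) in auto)
  then show ?thesis by (auto simp: model_space_iff)
qed

lemma model_space_lincomb:
  assumes "inner_function \<Theta>" "f \<in> model_space \<Theta>" "g \<in> model_space \<Theta>"
  shows "(\<lambda>z. a * f z + b * g z) \<in> model_space \<Theta>"
  using assms(2,3) inner_function_hardy2_mult[OF assms(1)]
  by (simp add: model_space_iff hardy2_lincomb hardy2_inner_lincomb_left)

lemma model_space_zero: "inner_function \<Theta> \<Longrightarrow> (\<lambda>z. 0) \<in> model_space \<Theta>"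
  using hardy2_inner_cnj[of _ "\<lambda>z. 0"] inner_function_hardy2_mult[of \<Theta>]
  by (simp add: model_space_iff hardy2_inner_const_right)

lemma model_space_sum:
  assumes "inner_function \<Theta>" "\<And>i. i \<in> A \<Longrightarrow> f i \<in> model_space \<Theta>"
  shows "(\<lambda>z. \<Sum>i\<in>A. c i * f i z) \<in> model_space \<Theta>"
  using assms(2)
proof (induction A rule: infinite_finite_induct)
  case (insert x A)
  from model_space_lincomb[OF assms(1), of "f x" "\<lambda>z. \<Sum>i\<in>A. c i * f i z" "c x" 1] insert show ?case
    by simp
qed (simp_all add: model_space_zero[OF assms(1)])

lemma model_space_closed:
  assumes \<Theta>: "inner_function \<Theta>" and f: "f \<in> hardy2" and g: "\<And>N. g N \<in> model_space \<Theta>"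
    and lim: "(\<lambda>N. h2norm (\<lambda>z. f z - g N z)) \<longlonglongrightarrow> 0"
  shows "f \<in> model_space \<Theta>"
  unfolding model_space_iff
proof (intro conjI ballI f)
  fix h assume h: "h \<in> hardy2"
  let ?k = "\<lambda>z. \<Theta> z * h z"
  have k: "?k \<in> hardy2" by (rule inner_function_hardy2_mult[OF \<Theta> h])
  have "cmod (hardy2_inner f ?k) \<le> h2norm (\<lambda>z. f z - g N z) * h2norm ?k" for N
  proof -
    have gN: "g N \<in> hardy2" by (rule model_space_hardy2[OF g])
    have "hardy2_inner (\<lambda>z. f z - g N z) ?k = hardy2_inner f ?k"
      using hardy2_inner_lincomb_left[OF f gN k, of 1 "-1"] g[of N] h by (simp add: model_space_iff)
    then show ?thesis using hardy2_inner_bounds(2)[OF hardy2_diff[OF f gN] k] by simp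
  qed
  moreover have "(\<lambda>N. h2norm (\<lambda>z. f z - g N z) * h2norm ?k) \<longlonglongrightarrow> 0 * h2norm ?k"
    by (intro tendsto_intros lim)
  ultimately have "cmod (hardy2_inner f ?k) \<le> 0"
    using LIMSEQ_le_const by fastforce
  then show "hardy2_inner f ?k = 0" by simp
qed

text \<open>
  The projection of the Szego kernel to the model space, hence the kernel of evaluation there.
\<close>
definition model_kernel :: "(complex \<Rightarrow> complex) \<Rightarrow> complex \<Rightarrow> complex \<Rightarrow> complex" where
  "model_kernel \<Theta> w z = (1 - cnj (\<Theta> w) * \<Theta> z) * szego w z"

text \<open>
  The squared norm of evaluation at \<open>w\<close> on the model space. It controls boundedness in both
  directions: where it stays bounded, so do all elements of the model space, and where it does not, some element
  is unbounded.
\<close>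
definition kernel_growth :: "(complex \<Rightarrow> complex) \<Rightarrow> complex \<Rightarrow> real" where
  "kernel_growth \<Theta> w = (1 - (cmod (\<Theta> w))\<^sup>2) / (1 - (cmod w)\<^sup>2)"

lemma model_kernel_split: "model_kernel \<Theta> w = (\<lambda>z. 1 * szego w z + (- cnj (\<Theta> w)) * (\<Theta> z * szego w z))"
  by (simp add: fun_eq_iff model_kernel_def algebra_simps)

lemma inner_function_inner_szego:
  assumes "inner_function \<Theta>" "w \<in> disk" "h \<in> hardy2"
  shows "hardy2_inner (szego w) (\<lambda>z. \<Theta> z * h z) = cnj (\<Theta> w * h w)"
    and "hardy2_inner (\<lambda>z. \<Theta> z * szego w z) (\<lambda>z. \<Theta> z * h z) = cnj (h w)"
proof -
  have k: "szego w \<in> hardy2" by (rule szego_hardy2[OF assms(2)])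
  have \<Theta>h: "(\<lambda>z. \<Theta> z * h z) \<in> hardy2" by (rule inner_function_hardy2_mult[OF assms(1,3)])
  show "hardy2_inner (szego w) (\<lambda>z. \<Theta> z * h z) = cnj (\<Theta> w * h w)"
    unfolding hardy2_inner_cnj[OF \<Theta>h k] szego_reproducing[OF \<Theta>h assms(2)] ..
  show "hardy2_inner (\<lambda>z. \<Theta> z * szego w z) (\<lambda>z. \<Theta> z * h z) = cnj (h w)"
    unfolding inner_function_inner[OF assms(1) k assms(3)] hardy2_inner_cnj[OF assms(3) k]
      szego_reproducing[OF assms(3,2)] ..
qed

lemma model_kernel_in_model_space:
  assumes \<Theta>: "inner_function \<Theta>" and w: "w \<in> disk"
  shows "model_kernel \<Theta> w \<in> model_space \<Theta>"
proof -
  note k = szego_hardy2[OF w] and \<Theta>k = inner_function_hardy2_mult[OF \<Theta> szego_hardy2[OF w]]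
  have "hardy2_inner (model_kernel \<Theta> w) (\<lambda>z. \<Theta> z * h z) = 0" if h: "h \<in> hardy2" for h
    unfolding model_kernel_split
      hardy2_inner_lincomb_left[OF k \<Theta>k inner_function_hardy2_mult[OF \<Theta> h]]
      inner_function_inner_szego[OF \<Theta> w h] by simp
  moreover have "model_kernel \<Theta> w \<in> hardy2"
    unfolding model_kernel_split by (rule hardy2_lincomb[OF k \<Theta>k])
  ultimately show ?thesis by (simp add: model_space_iff)
qed

lemma model_kernel_reproducing:
  assumes \<Theta>: "inner_function \<Theta>" and w: "w \<in> disk" and f: "f \<in> model_space \<Theta>"
  shows "hardy2_inner f (model_kernel \<Theta> w) = f w"
proof -
  note k = szego_hardy2[OF w] and \<Theta>k = inner_function_hardy2_mult[OF \<Theta> szego_hardy2[OF w]]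
  note f2 = model_space_hardy2[OF f]
  have "hardy2_inner f (\<lambda>z. \<Theta> z * szego w z) = 0"
    using f k by (simp add: model_space_iff)
  then show ?thesis
    unfolding model_kernel_split hardy2_inner_lincomb_right[OF k \<Theta>k f2] szego_reproducing[OF f2 w] by simp
qed

lemma model_kernel_h2norm:
  assumes \<Theta>: "inner_function \<Theta>" and w: "w \<in> disk"
  shows "(h2norm (model_kernel \<Theta> w))\<^sup>2 = kernel_growth \<Theta> w"
proof -
  note k = model_kernel_in_model_space[OF \<Theta> w]
  have "of_real ((h2norm (model_kernel \<Theta> w))\<^sup>2) = hardy2_inner (model_kernel \<Theta> w) (model_kernel \<Theta> w)"
    using hardy2_inner_self[OF model_space_hardy2[OF k]] by simp
  also have "\<dots> = model_kernel \<Theta> w w"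
    by (rule model_kernel_reproducing[OF \<Theta> w k])
  also have "\<dots> = of_real (kernel_growth \<Theta> w)"
    by (simp add: model_kernel_def kernel_growth_def szego_def complex_norm_square mult.commute
        del: of_real_power flip: of_real_mult)
  finally show ?thesis unfolding of_real_eq_iff .
qed

lemma model_space_growth:
  assumes \<Theta>: "inner_function \<Theta>" and w: "w \<in> disk" and f: "f \<in> model_space \<Theta>"
  shows "(cmod (f w))\<^sup>2 \<le> kernel_growth \<Theta> w * (h2norm f)\<^sup>2"
proof -
  have "cmod (f w) \<le> h2norm f * h2norm (model_kernel \<Theta> w)"
    using hardy2_inner_bounds(2)[OF model_space_hardy2[OF f] model_space_hardy2[OF model_kernel_in_model_space[OF \<Theta> w]]]
    by (simp add: model_kernel_reproducing[OF \<Theta> w f])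
  then have "(cmod (f w))\<^sup>2 \<le> (h2norm f * h2norm (model_kernel \<Theta> w))\<^sup>2"
    by (intro power_mono) auto
  then show ?thesis by (simp add: power_mult_distrib model_kernel_h2norm[OF \<Theta> w] mult.commute)
qed

lemma inner_function_id: "inner_function (\<lambda>z. z)"
proof -
  have "((\<lambda>r. of_real r * cis t) \<longlongrightarrow> of_real 1 * cis t) (at_left (1::real))" for t
    by (intro tendsto_intros)
  then have "\<exists>l. ((\<lambda>r. of_real r * cis t) \<longlongrightarrow> l) (at_left (1::real)) \<and> cmod l = 1" for t
    by (intro exI[of _ "cis t"]) simp
  then show ?thesis unfolding inner_function_def by (simp add: holomorphic_on_ident)
qed

lemma inner_function_mult:
  assumes "inner_function u" "inner_function v"
  shows "inner_function (\<lambda>z. u z * v z)"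
  unfolding inner_function_def
proof (intro conjI)
  show "(\<lambda>z. u z * v z) holomorphic_on disk"
    by (intro holomorphic_on_mult inner_function_holomorphic assms)
  have "cmod (u z * v z) \<le> 1" if "z \<in> disk" for z
    using inner_function_le_one[OF assms(1) that] inner_function_le_one[OF assms(2) that]
    by (simp add: norm_mult mult_le_one)
  then show "bounded ((\<lambda>z. u z * v z) ` disk)" unfolding bounded_iff by blast
  have "AE t in lebesgue_on {0..2 * pi}. \<exists>l. ((\<lambda>r. u (of_real r * cis t)) \<longlongrightarrow> l) (at_left 1) \<and> cmod l = 1"
    "AE t in lebesgue_on {0..2 * pi}. \<exists>l. ((\<lambda>r. v (of_real r * cis t)) \<longlongrightarrow> l) (at_left 1) \<and> cmod l = 1"
    using assms by (auto simp: inner_function_def)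
  then show "AE t in lebesgue_on {0..2 * pi}.
      \<exists>l. ((\<lambda>r. u (of_real r * cis t) * v (of_real r * cis t)) \<longlongrightarrow> l) (at_left 1) \<and> cmod l = 1"
  proof eventually_elim
    case (elim t)
    then obtain l m where "((\<lambda>r. u (of_real r * cis t)) \<longlongrightarrow> l) (at_left 1)" "cmod l = 1"
      "((\<lambda>r. v (of_real r * cis t)) \<longlongrightarrow> m) (at_left 1)" "cmod m = 1" by blast
    then show ?case by (intro exI[of _ "l * m"]) (simp add: tendsto_mult norm_mult)
  qed
qed

section \<open>Multipliers lie in the model space\<close>

text \<open>
  Two elements of the model space of \<open>u\<close> are tested. The kernel at \<open>0\<close>, \<open>d = 1 - cnj (u 0) u\<close>, is bounded
  below, so \<open>\<phi> d\<close> being in the Hardy space puts \<open>\<phi>\<close> there. The backward shift \<open>s = (u - u 0) / z\<close>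
  carries the orthogonality: multiplying both sides by the isometry \<open>z\<close> and cancelling the isometry \<open>u\<close>
  gives \<open>\<langle>\<phi> s, u h\<rangle> = \<langle>\<phi>, z d h\<rangle>\<close>. With \<open>h\<close> replaced by \<open>I h / d\<close> this is the
  defining relation of the model space of \<open>z I(z)\<close>, because \<open>1 / d\<close> is bounded.
\<close>
lemma multipliers_subset_model_space:
  assumes u: "inner_function u" and I: "inner_function I" and nc: "\<not> u constant_on disk"
    and v: "\<And>z. z \<in> disk \<Longrightarrow> v z = u z * I z" and \<phi>: "\<phi> \<in> multipliers u v"
  shows "\<phi> \<in> model_space (\<lambda>z. z * I z)"
proof -
  note uI = inner_function_mult[OF u I]
  have mv: "model_space v = model_space (\<lambda>z. u z * I z)"
    by (rule model_space_cong) (use inner_function_hardy2_mult[OF uI] v in auto)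
  have mult: "(\<lambda>z. \<phi> z * f z) \<in> model_space (\<lambda>z. u z * I z)" if "f \<in> model_space u" for f
    using \<phi> that by (auto simp: multipliers_def mv)
  define d where "d = (\<lambda>z. 1 - cnj (u 0) * u z)"
  have "model_kernel u 0 = d"
    by (simp add: fun_eq_iff model_kernel_def d_def szego_def)
  then have dK: "d \<in> model_space u"
    using model_kernel_in_model_space[OF u, of 0] by simp
  have u0: "cmod (u 0) < 1" by (rule inner_function_less_one[OF u nc]) simp
  have dbd: "1 - cmod (u 0) \<le> cmod (d z)" "d z \<noteq> 0" if "z \<in> disk" for z
  proof -
    have "cmod (cnj (u 0) * u z) \<le> cmod (u 0)"
      using inner_function_le_one[OF u that] by (simp add: norm_mult mult_left_le)
    then show "1 - cmod (u 0) \<le> cmod (d z)"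
      using norm_triangle_ineq2[of 1 "cnj (u 0) * u z"] by (simp add: d_def)
    then show "d z \<noteq> 0" using u0 by auto
  qed
  have dinv: "(\<lambda>z. 1 / d z * h z) \<in> hardy2" if "h \<in> hardy2" for h
  proof (rule hardy2_bounded_mult(1)[OF _ _ that])
    show "(\<lambda>z. 1 / d z) holomorphic_on disk"
      using dbd(2) hardy2_holomorphic[OF model_space_hardy2[OF dK]] by (intro holomorphic_intros) auto
    show "cmod (1 / d z) \<le> 1 / (1 - cmod (u 0))" if "z \<in> disk" for z
      using dbd[OF that] u0 by (simp add: norm_divide frac_le)
  qed
  have \<phi>2: "\<phi> \<in> hardy2"
    by (rule hardy2_cong[OF dinv[OF model_space_hardy2[OF mult[OF dK]]]]) (use dbd(2) in auto)
  have u2: "u \<in> hardy2" using inner_function_hardy2_mult[OF u hardy2_const[of 1]] by simp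
  obtain s where s: "s \<in> hardy2" "\<And>z. z \<in> disk \<Longrightarrow> u z = u 0 + z * s z"
    using hardy2_backward_shift[OF u2] by blast
  have zs: "z * s z = u z - u 0" if "z \<in> disk" for z
    using s(2)[OF that] by (metis add_diff_cancel_left')
  have key: "hardy2_inner (\<lambda>z. f z * s z) (\<lambda>z. u z * h z) = hardy2_inner f (\<lambda>z. z * (d z * h z))"
    if f: "f \<in> hardy2" and fs: "(\<lambda>z. f z * s z) \<in> hardy2" and h: "h \<in> hardy2" for f h
  proof -
    note uf = inner_function_hardy2_mult[OF u f] and uzh = inner_function_hardy2_mult[OF u hardy2_shift[OF h]]
    note zh = hardy2_shift[OF h]
    have "hardy2_inner (\<lambda>z. f z * s z) (\<lambda>z. u z * h z) =
        hardy2_inner (\<lambda>z. z * (f z * s z)) (\<lambda>z. z * (u z * h z))"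
      by (rule hardy2_inner_shift[symmetric, OF fs inner_function_hardy2_mult[OF u h]])
    also have "\<dots> = hardy2_inner (\<lambda>z. 1 * (u z * f z) + (- u 0) * f z) (\<lambda>z. z * (u z * h z))"
    proof (rule hardy2_inner_cong_left)
      show "(\<lambda>z. 1 * (u z * f z) + (- u 0) * f z) holomorphic_on disk"
        by (rule hardy2_holomorphic[OF hardy2_lincomb[OF uf f]])
      fix z assume "z \<in> disk"
      have "z * (f z * s z) = (z * s z) * f z" by simp
      then show "z * (f z * s z) = 1 * (u z * f z) + (- u 0) * f z"
        unfolding zs[OF \<open>z \<in> disk\<close>] by (simp add: algebra_simps)
    qed
    also have "(\<lambda>z. z * (u z * h z)) = (\<lambda>z. u z * (z * h z))" by (simp add: mult_ac)
    also have "hardy2_inner (\<lambda>z. 1 * (u z * f z) + (- u 0) * f z) (\<lambda>z. u z * (z * h z)) =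
        hardy2_inner f (\<lambda>z. 1 * (z * h z) + (- cnj (u 0)) * (u z * (z * h z)))"
      unfolding hardy2_inner_lincomb_left[OF uf f uzh] hardy2_inner_lincomb_right[OF zh uzh f]
        inner_function_inner[OF u f zh] by simp
    also have "(\<lambda>z. 1 * (z * h z) + (- cnj (u 0)) * (u z * (z * h z))) = (\<lambda>z. z * (d z * h z))"
      by (simp add: fun_eq_iff d_def algebra_simps)
    finally show ?thesis .
  qed
  have "s \<in> model_space u"
    unfolding model_space_iff
  proof (intro conjI ballI s(1))
    fix h assume h: "h \<in> hardy2"
    have dh: "(\<lambda>z. d z * h z) \<in> hardy2"
      using hardy2_lincomb[OF h inner_function_hardy2_mult[OF u h], of 1 "- cnj (u 0)"]
      by (simp add: d_def algebra_simps)
    have "hardy2_inner s (\<lambda>z. u z * h z) = hardy2_inner (\<lambda>z. 1) (\<lambda>z. z * (d z * h z))"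
      using key[of "\<lambda>z. 1" h] s(1) h by simp
    also have "\<dots> = 0"
      using hardy2_inner_cnj[OF hardy2_shift[OF dh] hardy2_const[of 1]] by (simp add: hardy2_inner_const_right)
    finally show "hardy2_inner s (\<lambda>z. u z * h z) = 0" .
  qed
  from mult[OF this] have \<phi>s: "(\<lambda>z. \<phi> z * s z) \<in> model_space (\<lambda>z. u z * I z)" .
  show ?thesis
    unfolding model_space_iff
  proof (intro conjI ballI \<phi>2)
    fix h assume h: "h \<in> hardy2"
    note h' = dinv[OF h]
    note Ih' = inner_function_hardy2_mult[OF I h']
    have "hardy2_inner \<phi> (\<lambda>z. z * I z * h z) = hardy2_inner \<phi> (\<lambda>z. z * (d z * (I z * (1 / d z * h z))))"
    proof (rule hardy2_inner_cong_right[symmetric])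
      show "(\<lambda>z. z * I z * h z) holomorphic_on disk"
        by (intro holomorphic_intros inner_function_holomorphic[OF I] hardy2_holomorphic[OF h])
    qed (use dbd(2) in auto)
    also have "\<dots> = hardy2_inner (\<lambda>z. \<phi> z * s z) (\<lambda>z. u z * (I z * (1 / d z * h z)))"
      by (rule key[symmetric, OF \<phi>2 model_space_hardy2[OF \<phi>s] Ih'])
    also have "\<dots> = hardy2_inner (\<lambda>z. \<phi> z * s z) (\<lambda>z. u z * I z * (1 / d z * h z))"
      by (simp add: mult.assoc)
    also have "\<dots> = 0"
      using bspec[OF conjunct2[OF \<phi>s[unfolded model_space_iff]] h'] .
    finally show "hardy2_inner \<phi> (\<lambda>z. z * I z * h z) = 0" .
  qed
qed

section \<open>Products of elements of model spaces\<close>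

text \<open>
  Since \<open>f\<close> is orthogonal to all multiples of \<open>u\<close> and \<open>z\<close> acts isometrically, \<open>z\<^sup>n f\<close> is orthogonal to all
  multiples of \<open>z\<^sup>n u\<close>; so only the first \<open>n\<close> Taylor coefficients of \<open>J\<close> enter, and these can be taken out
  one at a time by the backward shift.
\<close>
lemma inner_monomial_multiple:
  assumes u: "inner_function u" and f: "f \<in> model_space u" and h: "h \<in> hardy2"
    and J: "J holomorphic_on disk" "(\<lambda>z. J z * h z) \<in> hardy2"
  shows "hardy2_inner (\<lambda>z. z ^ n * f z) (\<lambda>z. u z * (J z * h z)) =
    (\<Sum>a<n. cnj (taylor_coeff J a) * hardy2_inner (\<lambda>z. z ^ (n - a) * f z) (\<lambda>z. u z * h z))"
  using J
proof (induction n arbitrary: J)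
  case 0
  then show ?case using f by (simp add: model_space_iff)
next
  case (Suc n)
  note uh = inner_function_hardy2_mult[OF u h]
  note zf = hardy2_shift_power[OF model_space_hardy2[OF f]]
  obtain K where K: "K holomorphic_on disk" "\<And>z. z \<in> disk \<Longrightarrow> J z = J 0 + z * K z"
    using holomorphic_backward_shift[OF Suc.prems(1)] by blast
  have coeff: "taylor_coeff J (Suc a) = taylor_coeff K a" for a
  proof -
    have zK: "(\<lambda>z. z * K z) holomorphic_on disk" by (intro holomorphic_intros K)
    have "taylor_coeff J (Suc a) = taylor_coeff (\<lambda>z. J 0 * 1 + 1 * (z * K z)) (Suc a)"
    proof (rule taylor_coeff_cong)
      show "(\<lambda>z. J 0 * 1 + 1 * (z * K z)) holomorphic_on disk" by (intro holomorphic_intros zK)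
      show "J z = J 0 * 1 + 1 * (z * K z)" if "z \<in> disk" for z using K(2)[OF that] by simp
    qed
    also have "\<dots> = J 0 * taylor_coeff (\<lambda>z. 1) (Suc a) + 1 * taylor_coeff (\<lambda>z. z * K z) (Suc a)"
      by (rule taylor_coeff_lincomb[OF holomorphic_on_const zK])
    also have "\<dots> = taylor_coeff K a"
      by (simp add: taylor_coeff_const taylor_coeff_shift[OF K(1)])
    finally show ?thesis .
  qed
  have "(\<lambda>z. z * (K z * h z)) \<in> hardy2"
  proof (rule hardy2_cong[OF hardy2_lincomb[OF Suc.prems(2) h]])
    fix z assume "z \<in> disk"
    show "z * (K z * h z) = 1 * (J z * h z) + (- J 0) * h z"
      using arg_cong[OF K(2)[OF \<open>z \<in> disk\<close>], of "\<lambda>x. x * h z"] by (simp add: distrib_right)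
  qed
  then have Kh: "(\<lambda>z. K z * h z) \<in> hardy2"
    by (subst (asm) hardy2_shift_iff) (intro holomorphic_intros K hardy2_holomorphic[OF h])
  note uKh = inner_function_hardy2_mult[OF u Kh]
  have "hardy2_inner (\<lambda>z. z ^ Suc n * f z) (\<lambda>z. u z * (J z * h z)) =
      hardy2_inner (\<lambda>z. z ^ Suc n * f z) (\<lambda>z. J 0 * (u z * h z) + 1 * (z * (u z * (K z * h z))))"
  proof (rule hardy2_inner_cong_right)
    show "(\<lambda>z. J 0 * (u z * h z) + 1 * (z * (u z * (K z * h z)))) holomorphic_on disk"
      by (rule hardy2_holomorphic[OF hardy2_lincomb[OF uh hardy2_shift[OF uKh]]])
    fix z assume "z \<in> disk"
    show "u z * (J z * h z) = J 0 * (u z * h z) + 1 * (z * (u z * (K z * h z)))"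
      using arg_cong[OF K(2)[OF \<open>z \<in> disk\<close>], of "\<lambda>x. u z * (x * h z)"] by (simp add: algebra_simps)
  qed
  also have "\<dots> = cnj (J 0) * hardy2_inner (\<lambda>z. z ^ Suc n * f z) (\<lambda>z. u z * h z) +
      hardy2_inner (\<lambda>z. z * (z ^ n * f z)) (\<lambda>z. z * (u z * (K z * h z)))"
    unfolding hardy2_inner_lincomb_right[OF uh hardy2_shift[OF uKh] zf] by (simp add: mult.assoc)
  also have "hardy2_inner (\<lambda>z. z * (z ^ n * f z)) (\<lambda>z. z * (u z * (K z * h z))) =
      hardy2_inner (\<lambda>z. z ^ n * f z) (\<lambda>z. u z * (K z * h z))"
    by (rule hardy2_inner_shift[OF zf uKh])
  also have "\<dots> = (\<Sum>a<n. cnj (taylor_coeff K a) * hardy2_inner (\<lambda>z. z ^ (n - a) * f z) (\<lambda>z. u z * h z))"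
    by (rule Suc.IH[OF K(1) Kh])
  finally show ?case
    unfolding sum.lessThan_Suc_shift by (simp add: coeff)
qed

text \<open>This is the orthogonal projection of \<open>z\<^sup>n\<close> onto the model space of \<open>z J(z)\<close>.\<close>
definition monomial_projection :: "(complex \<Rightarrow> complex) \<Rightarrow> nat \<Rightarrow> complex \<Rightarrow> complex" where
  "monomial_projection J n z = z ^ n - (\<Sum>a<n. cnj (taylor_coeff J a) * (z ^ (n - a) * J z))"

text \<open>
  By the previous formula the terms subtracted from \<open>z\<^sup>n\<close> cancel the inner products of \<open>z\<^sup>n f\<close> with
  \<open>u J h\<close>: in each of them the isometry \<open>J\<close> drops out on both sides.
\<close>
lemma monomial_projection_mult:
  assumes u: "inner_function u" and J: "inner_function J" and f: "f \<in> model_space u"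
  shows "(\<lambda>z. monomial_projection J n z * f z) \<in> model_space (\<lambda>z. u z * J z)"
proof -
  note f2 = model_space_hardy2[OF f]
  note zf = hardy2_shift_power[OF f2]
  note Jzf = inner_function_hardy2_mult[OF J zf]
  define S where "S = (\<lambda>z. \<Sum>a<n. cnj (taylor_coeff J a) * (J z * (z ^ (n - a) * f z)))"
  have S: "S \<in> hardy2" unfolding S_def by (intro hardy2_sum hardy2_cmult Jzf)
  have eq: "(\<lambda>z. monomial_projection J n z * f z) = (\<lambda>z. 1 * (z ^ n * f z) + (-1) * S z)"
    unfolding fun_eq_iff monomial_projection_def S_def left_diff_distrib sum_distrib_right
    by (simp add: mult_ac)
  have "hardy2_inner (\<lambda>z. 1 * (z ^ n * f z) + (-1) * S z) (\<lambda>z. u z * J z * h z) = 0" if h: "h \<in> hardy2" for h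
  proof -
    note Jh = inner_function_hardy2_mult[OF J h] and uh = inner_function_hardy2_mult[OF u h]
    have assoc: "(\<lambda>z. u z * J z * h z) = (\<lambda>z. u z * (J z * h z))" "(\<lambda>z. u z * J z * h z) = (\<lambda>z. J z * (u z * h z))"
      by (simp_all add: mult_ac)
    have Sinner: "hardy2_inner S (\<lambda>z. J z * (u z * h z)) =
        (\<Sum>a<n. cnj (taylor_coeff J a) * hardy2_inner (\<lambda>z. z ^ (n - a) * f z) (\<lambda>z. u z * h z))"
    proof -
      have "hardy2_inner (\<lambda>z. \<Sum>a\<in>A. cnj (taylor_coeff J a) * (J z * (z ^ (n - a) * f z))) (\<lambda>z. J z * (u z * h z)) =
        (\<Sum>a\<in>A. cnj (taylor_coeff J a) * hardy2_inner (\<lambda>z. z ^ (n - a) * f z) (\<lambda>z. u z * h z))" if "finite A" for A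
        using that
      proof (induction A)
        case empty
        show ?case
          using hardy2_inner_cnj[of "\<lambda>z. J z * (u z * h z)" "\<lambda>z. 0"] inner_function_hardy2_mult[OF J uh]
          by (simp add: hardy2_inner_const_right)
      next
        case (insert x A)
        have "(\<lambda>z. \<Sum>a\<in>A. cnj (taylor_coeff J a) * (J z * (z ^ (n - a) * f z))) \<in> hardy2"
          by (intro hardy2_sum hardy2_cmult Jzf)
        from hardy2_inner_lincomb_left[OF Jzf this inner_function_hardy2_mult[OF J uh], of "cnj (taylor_coeff J x)" "n - x" 1]
        show ?case
          using insert by (simp add: inner_function_inner[OF J zf uh])
      qed
      then show ?thesis unfolding S_def by simp
    qed
    show ?thesis
      unfolding assoc(1) hardy2_inner_lincomb_left[OF zf S inner_function_hardy2_mult[OF u Jh]]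
        inner_monomial_multiple[OF u f h inner_function_holomorphic[OF J] Jh]
      using Sinner by (simp add: assoc[symmetric])
  qed
  then show ?thesis
    unfolding eq model_space_iff using hardy2_lincomb[OF zf S] by blast
qed

text \<open>
  The constant \<open>1\<close> spans the model space of \<open>z\<close>, so this is the case \<open>u = z\<close>, \<open>f = 1\<close> of the product
  rule.
\<close>
lemma monomial_projection_in_model_space:
  assumes J: "inner_function J"
  shows "monomial_projection J n \<in> model_space (\<lambda>z. z * J z)"
proof -
  have "hardy2_inner (\<lambda>z. 1) (\<lambda>z. z * h z) = 0" if "h \<in> hardy2" for h
    using hardy2_inner_cnj[OF hardy2_shift[OF that] hardy2_const[of 1]] by (simp add: hardy2_inner_const_right)
  then have "(\<lambda>z. 1) \<in> model_space (\<lambda>z. z)" by (simp add: model_space_iff)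
  from monomial_projection_mult[OF inner_function_id J this] show ?thesis by simp
qed

text \<open>
  The combination of projections differs from the Taylor polynomial by a multiple of \<open>z J(z)\<close>, which is
  orthogonal to the model space; by Pythagoras it is at least as close to \<open>\<phi>\<close> as the Taylor polynomial.
\<close>
lemma monomial_projections_approximate:
  assumes J: "inner_function J" and \<phi>: "\<phi> \<in> model_space (\<lambda>z. z * J z)"
  shows "(\<lambda>N. h2norm (\<lambda>z. \<phi> z - (\<Sum>n<N. taylor_coeff \<phi> n * monomial_projection J n z))) \<longlonglongrightarrow> 0"
proof (rule tendsto_sandwich[OF _ _ tendsto_const taylor_poly_tendsto[OF model_space_hardy2[OF \<phi>]]])
  let ?\<Theta> = "\<lambda>z. z * J z"
  note \<Theta> = inner_function_mult[OF inner_function_id J]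
  show "\<forall>\<^sub>F N in sequentially. h2norm (\<lambda>z. \<phi> z - (\<Sum>n<N. taylor_coeff \<phi> n * monomial_projection J n z))
      \<le> h2norm (\<lambda>z. \<phi> z - (\<Sum>n<N. taylor_coeff \<phi> n * z ^ n))"
  proof (rule always_eventually, rule allI)
    fix N
    define A where "A = (\<lambda>z. 1 * \<phi> z + (-1) * (\<Sum>n<N. taylor_coeff \<phi> n * monomial_projection J n z))"
    define Q where "Q = (\<lambda>z. \<Sum>n<N. taylor_coeff \<phi> n * (\<Sum>a<n. cnj (taylor_coeff J a) * z ^ (n - a - 1)))"
    have A: "A \<in> model_space ?\<Theta>"
      unfolding A_def by (intro model_space_lincomb model_space_sum monomial_projection_in_model_space \<Theta> J \<phi>)
    have Q: "Q \<in> hardy2" unfolding Q_def by (intro hardy2_sum hardy2_cmult) simp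
    note \<Theta>Q = inner_function_hardy2_mult[OF \<Theta> Q]
    have mp: "monomial_projection J n z = z ^ n - z * J z * (\<Sum>a<n. cnj (taylor_coeff J a) * z ^ (n - a - 1))" for n z
    proof -
      have "z ^ (n - a) = z * z ^ (n - a - 1)" if "a < n" for a
        using that by (metis Suc_diff_Suc diff_Suc_eq_diff_pred diff_commute power_Suc)
      then show ?thesis
        unfolding monomial_projection_def sum_distrib_left
        by (intro arg_cong2[where f = minus] sum.cong) (auto simp: mult_ac)
    qed
    have "(h2norm (\<lambda>z. A z + (-1) * (z * J z * Q z)))\<^sup>2 = (h2norm A)\<^sup>2 + (h2norm (\<lambda>z. z * J z * Q z))\<^sup>2"
      using h2norm_lincomb_sq[OF model_space_hardy2[OF A] \<Theta>Q, of "-1"] A Q by (simp add: model_space_iff)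
    moreover have "(\<lambda>z. A z + (-1) * (z * J z * Q z)) = (\<lambda>z. \<phi> z - (\<Sum>n<N. taylor_coeff \<phi> n * z ^ n))"
      by (simp add: fun_eq_iff A_def Q_def mp right_diff_distrib sum_subtractf sum_negf sum_distrib_left mult_ac)
    ultimately have "(h2norm A)\<^sup>2 \<le> (h2norm (\<lambda>z. \<phi> z - (\<Sum>n<N. taylor_coeff \<phi> n * z ^ n)))\<^sup>2"
      by simp
    then have "h2norm A \<le> h2norm (\<lambda>z. \<phi> z - (\<Sum>n<N. taylor_coeff \<phi> n * z ^ n))"
      by (rule power2_le_imp_le) simp
    then show "h2norm (\<lambda>z. \<phi> z - (\<Sum>n<N. taylor_coeff \<phi> n * monomial_projection J n z))
      \<le> h2norm (\<lambda>z. \<phi> z - (\<Sum>n<N. taylor_coeff \<phi> n * z ^ n))"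
      by (simp add: A_def)
  qed
qed (simp add: always_eventually)

text \<open>
  If at every point one of the two evaluation functionals has squared norm at most \<open>C\<close>, then \<open>|\<psi> f|\<close> is dominated
  by a combination of \<open>|\<psi>|\<close> and \<open>|f|\<close>, and multiplication by a fixed \<open>f\<close> is bounded in \<open>\<psi>\<close>. It therefore
  suffices to treat the approximating projections, for which the product rule applies.
\<close>
lemma model_space_subset_multipliers:
  assumes u: "inner_function u" and I: "inner_function I"
    and C: "\<And>z. z \<in> disk \<Longrightarrow> kernel_growth u z \<le> C \<or> kernel_growth (\<lambda>z. z * I z) z \<le> C"
    and \<phi>: "\<phi> \<in> model_space (\<lambda>z. z * I z)" and f: "f \<in> model_space u"
  shows "(\<lambda>z. \<phi> z * f z) \<in> model_space (\<lambda>z. u z * I z)"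
proof -
  let ?\<Theta> = "\<lambda>z. z * I z"
  note \<Theta> = inner_function_mult[OF inner_function_id I] and uI = inner_function_mult[OF u I]
  note f2 = model_space_hardy2[OF f]
  define D where "D = max C 0"
  have prod: "(\<lambda>z. \<psi> z * f z) \<in> hardy2 \<and> (h2norm (\<lambda>z. \<psi> z * f z))\<^sup>2 \<le> 2 * D * (h2norm f)\<^sup>2 * (h2norm \<psi>)\<^sup>2"
    if \<psi>: "\<psi> \<in> model_space ?\<Theta>" for \<psi>
  proof -
    note \<psi>2 = model_space_hardy2[OF \<psi>]
    have "(\<lambda>z. \<psi> z * f z) holomorphic_on disk"
      by (intro holomorphic_on_mult hardy2_holomorphic \<psi>2 f2)
    moreover have "(cmod (\<psi> z * f z))\<^sup>2 \<le>
        (D * (h2norm f)\<^sup>2) * (cmod (\<psi> z))\<^sup>2 + (D * (h2norm \<psi>)\<^sup>2) * (cmod (f z))\<^sup>2" if z: "z \<in> disk" for z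
    proof -
      have nn: "0 \<le> (D * (h2norm f)\<^sup>2) * (cmod (\<psi> z))\<^sup>2" "0 \<le> (D * (h2norm \<psi>)\<^sup>2) * (cmod (f z))\<^sup>2"
        by (simp_all add: D_def)
      consider "kernel_growth u z \<le> D" | "kernel_growth ?\<Theta> z \<le> D"
        using C[OF z] by (auto simp: D_def)
      then show ?thesis
      proof cases
        case 1
        have "(cmod (f z))\<^sup>2 \<le> D * (h2norm f)\<^sup>2"
          using model_space_growth[OF u z f] mult_right_mono[OF 1, of "(h2norm f)\<^sup>2"] by simp
        from mult_left_mono[OF this, of "(cmod (\<psi> z))\<^sup>2"] nn show ?thesis
          by (simp add: norm_mult power_mult_distrib mult.commute)
      next
        case 2
        have "(cmod (\<psi> z))\<^sup>2 \<le> D * (h2norm \<psi>)\<^sup>2"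
          using model_space_growth[OF \<Theta> z \<psi>] mult_right_mono[OF 2, of "(h2norm \<psi>)\<^sup>2"] by simp
        from mult_right_mono[OF this, of "(cmod (f z))\<^sup>2"] nn show ?thesis
          by (simp add: norm_mult power_mult_distrib)
      qed
    qed
    moreover have "0 \<le> D * (h2norm f)\<^sup>2" "0 \<le> D * (h2norm \<psi>)\<^sup>2"
      by (auto simp: D_def intro: mult_nonneg_nonneg)
    ultimately have "(\<lambda>z. \<psi> z * f z) \<in> hardy2"
      "(h2norm (\<lambda>z. \<psi> z * f z))\<^sup>2 \<le> (D * (h2norm f)\<^sup>2) * (h2norm \<psi>)\<^sup>2 + (D * (h2norm \<psi>)\<^sup>2) * (h2norm f)\<^sup>2"
      using hardy2_dominated[OF _ \<psi>2 f2, of "\<lambda>z. \<psi> z * f z" "D * (h2norm f)\<^sup>2" "D * (h2norm \<psi>)\<^sup>2"] by blast+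
    then show ?thesis by (simp add: algebra_simps)
  qed
  define p where "p = (\<lambda>N z. \<Sum>n<N. taylor_coeff \<phi> n * monomial_projection I n z)"
  show ?thesis
  proof (rule model_space_closed[OF uI])
    show "(\<lambda>z. \<phi> z * f z) \<in> hardy2" using prod[OF \<phi>] by simp
    show "(\<lambda>z. p N z * f z) \<in> model_space (\<lambda>z. u z * I z)" for N
    proof -
      have "(\<lambda>z. \<Sum>n<N. taylor_coeff \<phi> n * (monomial_projection I n z * f z)) \<in> model_space (\<lambda>z. u z * I z)"
        by (intro model_space_sum[OF uI] monomial_projection_mult u I f)
      then show ?thesis by (simp add: p_def sum_distrib_right mult.assoc)
    qed
    have "p N \<in> model_space ?\<Theta>" for N
      unfolding p_def by (intro model_space_sum[OF \<Theta>] monomial_projection_in_model_space I)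
    from model_space_lincomb[OF \<Theta> \<phi> this, of 1 "-1"]
    have "(\<lambda>z. \<phi> z - p N z) \<in> model_space ?\<Theta>" for N by simp
    note diff = prod[OF this]
    have le: "h2norm (\<lambda>z. \<phi> z * f z - p N z * f z) \<le> sqrt (2 * D * (h2norm f)\<^sup>2) * h2norm (\<lambda>z. \<phi> z - p N z)" for N
    proof (rule power2_le_imp_le)
      show "(h2norm (\<lambda>z. \<phi> z * f z - p N z * f z))\<^sup>2 \<le> (sqrt (2 * D * (h2norm f)\<^sup>2) * h2norm (\<lambda>z. \<phi> z - p N z))\<^sup>2"
        using diff[of N] by (simp add: left_diff_distrib power_mult_distrib D_def)
    qed (simp add: D_def)
    have "(\<lambda>N. sqrt (2 * D * (h2norm f)\<^sup>2) * h2norm (\<lambda>z. \<phi> z - p N z)) \<longlonglongrightarrow> sqrt (2 * D * (h2norm f)\<^sup>2) * 0"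
      unfolding p_def by (intro tendsto_intros monomial_projections_approximate I \<phi>)
    then have lim: "(\<lambda>N. sqrt (2 * D * (h2norm f)\<^sup>2) * h2norm (\<lambda>z. \<phi> z - p N z)) \<longlonglongrightarrow> 0"
      by simp
    show "(\<lambda>N. h2norm (\<lambda>z. \<phi> z * f z - p N z * f z)) \<longlonglongrightarrow> 0"
      by (rule Lim_null_comparison[OF _ lim]) (rule always_eventually, use le in simp)
  qed
qed

section \<open>Boundary regularity away from the spectrum\<close>

text \<open>
  Subtracting the Cauchy formula at the mirror image of the point, where the integral vanishes,
  leaves the Poisson kernel of the half-plane on the bottom edge. Both points keep a distance of
  at least \<open>a/2\<close> from the other edges, so these contribute only \<open>O(Im w)\<close>.
\<close>
lemma rectangle_poisson:
  fixes a M x y :: real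
  defines "w \<equiv> Complex x y"
  assumes a: "0 < a" and x: "\<bar>x\<bar> \<le> a / 2" and y: "0 < y" "y \<le> a / 2"
    and S: "open S" "convex S" "cbox (Complex (-a) 0) (Complex a a) \<subseteq> S"
    and g: "g holomorphic_on S" and M: "\<And>z. z \<in> cbox (Complex (-a) 0) (Complex a a) \<Longrightarrow> cmod (g z) \<le> M"
  shows "cmod (g w - integral {-a..a} (\<lambda>s. g (of_real s) * of_real (y / (pi * ((s - x)\<^sup>2 + y\<^sup>2))))) \<le> 16 * M * y / a"
proof -
  define R where "R = cbox (Complex (-a) 0) (Complex a a)"
  let ?\<gamma> = "rectpath (Complex (-a) 0) (Complex a a)"
  define h where "h = (\<lambda>z. g z * (2 * \<i> * of_real y) / ((z - w) * (z - cnj w)))"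
  have w: "Re w = x" "Im w = y" by (auto simp: w_def)
  have M0: "0 \<le> M" using order_trans[OF norm_ge_zero M[of 0]] a by (simp add: in_cbox_complex_iff)
  have img: "path_image ?\<gamma> \<subseteq> R" "w \<notin> path_image ?\<gamma>" "cnj w \<notin> R"
    using path_image_rectpath_subset_cbox[of "Complex (-a) 0" "Complex a a"] a x y
    by (auto simp: R_def path_image_rectpath in_cbox_complex_iff w)
  have wbox: "w \<in> box (Complex (-a) 0) (Complex a a)"
    using a x y by (auto simp: in_box_complex_iff w)
  have "((\<lambda>z. g z / (z - w)) has_contour_integral (2 * pi * \<i> * winding_number ?\<gamma> w * g w)) ?\<gamma>"
    by (rule Cauchy_integral_formula_convex_simple[OF S(2) g])
      (use wbox box_subset_cbox S img in \<open>auto simp: R_def interior_open\<close>)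
  then have 1: "((\<lambda>z. g z / (z - w)) has_contour_integral (2 * pi * \<i> * g w)) ?\<gamma>"
    using winding_number_rectpath[OF wbox] by simp
  \<comment> \<open>The mirror image lies outside \<open>T\<close>, so Cauchy's theorem applies to its kernel on a convex set.\<close>
  define T where "T = S \<inter> {z. Im z > - y}"
  have T: "convex T" "R \<subseteq> T"
    using S y by (auto simp: T_def R_def in_cbox_complex_iff intro!: convex_Int convex_halfspace_Im_gt)
  have 2: "((\<lambda>z. g z / (z - cnj w)) has_contour_integral 0) ?\<gamma>"
  proof (rule Cauchy_theorem_convex_simple[OF _ T(1)])
    show "(\<lambda>z. g z / (z - cnj w)) holomorphic_on T"
      by (intro holomorphic_intros holomorphic_on_subset[OF g]) (auto simp: T_def w)
  qed (use img T in auto)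
  have "(h has_contour_integral (2 * pi * \<i> * g w)) ?\<gamma>"
  proof (rule has_contour_integral_eq)
    show "((\<lambda>z. g z / (z - w) - g z / (z - cnj w)) has_contour_integral (2 * pi * \<i> * g w)) ?\<gamma>"
      using has_contour_integral_diff[OF 1 2] by simp
    fix z assume "z \<in> path_image ?\<gamma>"
    then have nz: "z - w \<noteq> 0" "z - cnj w \<noteq> 0" using img by auto
    have "w - cnj w = 2 * \<i> * of_real y" by (simp add: complex_eq_iff w)
    then have "h z = g z * ((z - cnj w) - (z - w)) / ((z - w) * (z - cnj w))"
      by (simp add: h_def)
    then show "g z / (z - w) - g z / (z - cnj w) = h z"
      using nz by (simp add: field_simps)
  qed
  then have total: "contour_integral ?\<gamma> h = 2 * pi * \<i> * g w"
    by (rule contour_integral_unique)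
  define c1 c2 c3 c4 where "c1 = Complex (-a) 0" "c2 = Complex a 0" "c3 = Complex a a" "c4 = Complex (-a) a"
  note c = c1_c2_c3_c4_def
  have conth: "continuous_on (R - {w}) h"
    unfolding h_def using img(3)
    by (intro continuous_intros holomorphic_on_imp_continuous_on holomorphic_on_subset[OF g]) (use S(3) in \<open>auto simp: R_def\<close>)
  have segs: "closed_segment c1 c2 \<subseteq> R - {w}" "closed_segment c2 c3 \<subseteq> R - {w}"
      "closed_segment c3 c4 \<subseteq> R - {w}" "closed_segment c4 c1 \<subseteq> R - {w}"
    using a x y by (auto simp: c R_def closed_segment_same_Re closed_segment_same_Im
        closed_segment_eq_real_ivl in_cbox_complex_iff w)
  have int: "h contour_integrable_on linepath c1 c2" "h contour_integrable_on linepath c2 c3"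
      "h contour_integrable_on linepath c3 c4" "h contour_integrable_on linepath c4 c1"
    by (intro contour_integrable_continuous_linepath continuous_on_subset[OF conth] segs)+
  have split: "contour_integral ?\<gamma> h = contour_integral (linepath c1 c2) h + (contour_integral (linepath c2 c3) h
      + (contour_integral (linepath c3 c4) h + contour_integral (linepath c4 c1) h))"
  proof -
    have "?\<gamma> = linepath c1 c2 +++ linepath c2 c3 +++ linepath c3 c4 +++ linepath c4 c1"
      by (simp add: rectpath_def Let_def c)
    then show ?thesis using int by (simp add: contour_integrable_joinI)
  qed
  have hbd: "cmod (h z) \<le> 8 * M * y / a\<^sup>2" if "z \<in> R" "a / 2 \<le> cmod (z - w)" "a / 2 \<le> cmod (z - cnj w)" for z
  proof -
    have "cmod (h z) = cmod (g z) * (2 * y) / (cmod (z - w) * cmod (z - cnj w))"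
      using y by (simp add: h_def norm_mult norm_divide)
    also have "\<dots> \<le> M * (2 * y) / ((a / 2) * (a / 2))"
      using M[of z] that a y M0 by (intro frac_le mult_mono) (auto simp: R_def)
    also have "\<dots> = 8 * M * y / a\<^sup>2"
      by (simp add: power2_eq_square)
    finally show ?thesis .
  qed
  have dist: "a / 2 \<le> cmod (z - w)" "a / 2 \<le> cmod (z - cnj w)"
    if "z \<in> closed_segment c2 c3 \<or> z \<in> closed_segment c3 c4 \<or> z \<in> closed_segment c4 c1" for z
  proof -
    have "Re z = a \<or> Im z = a \<or> Re z = -a"
      using that a by (auto simp: c closed_segment_same_Re closed_segment_same_Im)
    then have "a / 2 \<le> \<bar>Re (z - w)\<bar> \<or> a / 2 \<le> Im (z - w)" "a / 2 \<le> \<bar>Re (z - cnj w)\<bar> \<or> a / 2 \<le> Im (z - cnj w)"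
      using x y a by (auto simp: w)
    then show "a / 2 \<le> cmod (z - w)" "a / 2 \<le> cmod (z - cnj w)"
      using abs_Re_le_cmod abs_Im_le_cmod by (smt (verit))+
  qed
  have hseg: "cmod (h z) \<le> 8 * M * y / a\<^sup>2"
    if "z \<in> closed_segment c2 c3 \<or> z \<in> closed_segment c3 c4 \<or> z \<in> closed_segment c4 c1" for z
    using hbd[OF _ dist[OF that]] that segs(2-4) by auto
  have B0: "0 \<le> 8 * M * y / a\<^sup>2" using M0 y by simp
  have e2: "cmod (contour_integral (linepath c2 c3) h) \<le> 8 * M * y / a\<^sup>2 * cmod (c3 - c2)"
    by (rule contour_integral_bound_linepath[OF int(2) B0]) (simp add: hseg)
  have e3: "cmod (contour_integral (linepath c3 c4) h) \<le> 8 * M * y / a\<^sup>2 * cmod (c4 - c3)"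
    by (rule contour_integral_bound_linepath[OF int(3) B0]) (simp add: hseg)
  have e4: "cmod (contour_integral (linepath c4 c1) h) \<le> 8 * M * y / a\<^sup>2 * cmod (c1 - c4)"
    by (rule contour_integral_bound_linepath[OF int(4) B0]) (simp add: hseg)
  have len: "cmod (c3 - c2) = a" "cmod (c4 - c3) = 2 * a" "cmod (c1 - c4) = a"
    using a by (auto simp: c cmod_def real_sqrt_mult)
  have E: "cmod (contour_integral ?\<gamma> h - contour_integral (linepath c1 c2) h) \<le> 32 * M * y / a"
  proof -
    have "cmod (contour_integral ?\<gamma> h - contour_integral (linepath c1 c2) h) \<le>
        cmod (contour_integral (linepath c2 c3) h) + (cmod (contour_integral (linepath c3 c4) h) + cmod (contour_integral (linepath c4 c1) h))"
      unfolding split add_diff_cancel_left'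
      by (intro order_trans[OF norm_triangle_ineq] add_left_mono norm_triangle_ineq)
    also have "\<dots> \<le> 8 * M * y / a\<^sup>2 * a + (8 * M * y / a\<^sup>2 * (2 * a) + 8 * M * y / a\<^sup>2 * a)"
      using e2 e3 e4 unfolding len by linarith
    also have "\<dots> = 32 * M * y / a" using a by (simp add: power2_eq_square field_simps)
    finally show ?thesis .
  qed
  define P where "P = integral {-a..a} (\<lambda>s. g (of_real s) * of_real (y / (pi * ((s - x)\<^sup>2 + y\<^sup>2))))"
  have "contour_integral (linepath c1 c2) h = integral {-a..a} (\<lambda>s. h (of_real s))"
    using contour_integral_linepath_Reals_eq[of c1 c2 h] a by (simp add: c complex_is_Real_iff)
  also have "\<dots> = integral {-a..a} (\<lambda>s. (2 * pi * \<i>) * (g (of_real s) * of_real (y / (pi * ((s - x)\<^sup>2 + y\<^sup>2)))))"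
  proof (rule integral_cong)
    fix s
    have "(of_real s - w) * (of_real s - cnj w) = of_real ((s - x)\<^sup>2 + y\<^sup>2)"
      by (simp add: complex_eq_iff w power2_eq_square algebra_simps)
    moreover have "g (of_real s) * (2 * \<i> * of_real y) / of_real q = (2 * pi * \<i>) * (g (of_real s) * of_real (y / (pi * q)))" for q
      by (cases "q = 0") (simp_all add: field_simps)
    ultimately show "h (of_real s) = (2 * pi * \<i>) * (g (of_real s) * of_real (y / (pi * ((s - x)\<^sup>2 + y\<^sup>2))))"
      by (simp only: h_def)
  qed
  also have "\<dots> = (2 * pi * \<i>) * P" unfolding P_def by (rule integral_mult_right)
  finally have "cmod ((2 * pi * \<i>) * (g w - P)) \<le> 32 * M * y / a"
    using E unfolding total by (simp add: right_diff_distrib)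
  then have "2 * pi * cmod (g w - P) \<le> 32 * M * y / a" by (simp add: norm_mult)
  moreover have "2 * cmod (g w - P) \<le> 2 * pi * cmod (g w - P)"
    using pi_gt3 by (intro mult_right_mono) auto
  ultimately show ?thesis by (simp add: P_def)
qed

text \<open>
  On a horizontal line close to the real axis, \<open>g\<close> and the conjugate of \<open>1/g\<close> nearly agree, so
  their Poisson integrals do; hence \<open>g\<close> and the conjugate of \<open>1/g\<close> differ by \<open>O(Im w)\<close> at \<open>w\<close>. This
  is the quantitative content of Schwarz reflection.
\<close>
lemma reflection_estimate:
  fixes a \<delta> :: real
  assumes a: "0 < a" and \<delta>: "0 < \<delta>" and H: "H = ball 0 (4 * a) \<inter> {z. 0 < Im z}"
    and g: "g holomorphic_on H" "\<And>z. z \<in> H \<Longrightarrow> \<delta> \<le> cmod (g z)" "\<And>z. z \<in> H \<Longrightarrow> cmod (g z) \<le> 1"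
    and lim: "AE s in lebesgue_on {-a..a}. ((\<lambda>\<eta>. cmod (g (Complex s \<eta>))) \<longlongrightarrow> 1) (at_right 0)"
    and w: "\<bar>Re w\<bar> \<le> a / 2" "0 < Im w" "Im w \<le> a / 2"
  shows "1 - (cmod (g w))\<^sup>2 \<le> (16 + 16 / \<delta>) / a * Im w"
proof -
  define x y where "x = Re w" and "y = Im w"
  have wxy: "w = Complex x y" by (simp add: x_def y_def)
  have xy: "\<bar>x\<bar> \<le> a / 2" "0 < y" "y \<le> a / 2" using w by (auto simp: x_def y_def)
  \<comment> \<open>The estimate is made on lines at height \<open>\<eta> k\<close>, where \<open>g\<close> is holomorphic, and passes to the limit.\<close>
  define \<eta> where "\<eta> = (\<lambda>k::nat. a / real (k + 2))"
  have \<eta>: "0 < \<eta> k" "\<eta> k < a" for k using a by (auto simp: \<eta>_def field_simps add_pos_nonneg)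
  have \<eta>lim: "\<eta> \<longlonglongrightarrow> 0"
    unfolding \<eta>_def using LIMSEQ_ignore_initial_segment[OF lim_const_over_n[of a], of 2] by simp
  have gnz: "g z \<noteq> 0" if "z \<in> H" for z using g(2)[OF that] \<delta> by auto
  have inH: "z + \<i> * of_real (\<eta> k) \<in> H" if "z \<in> cbox (Complex (-a) 0) (Complex a a)" for z k
  proof -
    have "cmod (z + \<i> * of_real (\<eta> k)) \<le> \<bar>Re z\<bar> + \<bar>Im z + \<eta> k\<bar>"
      using cmod_le[of "z + \<i> * of_real (\<eta> k)"] by simp
    also have "\<dots> < 4 * a" using that \<eta>[of k] a by (auto simp: in_cbox_complex_iff)
    finally show ?thesis using that \<eta>[of k] by (auto simp: H in_cbox_complex_iff)
  qed
  define P where "P = (\<lambda>s. y / (pi * ((s - x)\<^sup>2 + y\<^sup>2)))"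
  have P: "0 \<le> P s" "P s \<le> 1 / (pi * y)" for s
  proof -
    show "0 \<le> P s" using xy by (simp add: P_def)
    have "y / (pi * ((s - x)\<^sup>2 + y\<^sup>2)) \<le> y / (pi * y\<^sup>2)"
      using xy by (intro divide_left_mono mult_left_mono mult_pos_pos add_nonneg_pos) auto
    then show "P s \<le> 1 / (pi * y)" using xy by (simp add: P_def power2_eq_square)
  qed
  have contP: "continuous_on {-a..a} (\<lambda>s. complex_of_real (P s))"
  proof -
    have "pi * ((s - x)\<^sup>2 + y\<^sup>2) \<noteq> 0" for s using xy by (simp add: add_nonneg_pos less_imp_neq[symmetric])
    then show ?thesis unfolding P_def by (intro continuous_intros) auto
  qed
  define G where "G = (\<lambda>k s. g (of_real s + \<i> * of_real (\<eta> k)))"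
  have realbox: "of_real s \<in> cbox (Complex (-a) 0) (Complex a a)" if "s \<in> {-a..a}" for s
    using that a by (auto simp: in_cbox_complex_iff)
  have contG: "continuous_on {-a..a} (G k)" for k
    unfolding G_def
    by (rule continuous_on_compose2[OF holomorphic_on_imp_continuous_on[OF g(1)]])
      (use inH realbox in \<open>auto intro!: continuous_intros\<close>)
  have Gnz: "G k s \<noteq> 0" if "s \<in> {-a..a}" for k s
    unfolding G_def using gnz[OF inH[OF realbox[OF that]]] .
  define J where "J = (\<lambda>k. integral {-a..a} (\<lambda>s. 1 - (cmod (G k s))\<^sup>2))"
  have Jlim: "J \<longlonglongrightarrow> integral {-a..a} (\<lambda>s. 0)"
    unfolding J_def
  proof (rule integral_tendsto_AE[where M = 1])
    show "continuous_on {-a..a} (\<lambda>s. 1 - (cmod (G k s))\<^sup>2)" for k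
      by (intro continuous_intros contG)
    show "\<bar>1 - (cmod (G k s))\<^sup>2\<bar> \<le> 1" if "s \<in> {-a..a}" for k s
      using g(3)[OF inH[OF realbox[OF that], of k]] by (simp add: G_def abs_square_le_1 abs_le_iff)
    show "AE s in lebesgue_on {-a..a}. (\<lambda>k. 1 - (cmod (G k s))\<^sup>2) \<longlonglongrightarrow> 0"
      using lim
    proof eventually_elim
      case (elim s)
      have "filterlim \<eta> (at_right 0) sequentially"
        unfolding filterlim_at using \<eta>lim \<eta> by (auto intro!: always_eventually) (metis less_irrefl)
      from filterlim_compose[OF elim this]
      have "(\<lambda>k. cmod (G k s)) \<longlonglongrightarrow> 1"
        by (simp add: G_def Complex_eq)
      then have "(\<lambda>k. 1 - (cmod (G k s))\<^sup>2) \<longlonglongrightarrow> 1 - 1\<^sup>2" by (intro tendsto_intros)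
      then show ?case by simp
    qed
  qed (intro continuous_intros)
  \<comment> \<open>\<open>F\<close> is \<open>g\<close> shifted down by \<open>\<eta> k\<close>; the kernel \<open>P\<close> is real, so conjugation commutes with the Poisson integral.\<close>
  have bound: "1 - (cmod (g (w + \<i> * of_real (\<eta> k))))\<^sup>2 \<le> (16 + 16 / \<delta>) / a * y + 1 / (\<delta> * (pi * y)) * J k" for k
  proof -
    define S where "S = (\<lambda>z. z + \<i> * of_real (\<eta> k)) -` H"
    have openH: "open H" "convex H"
      unfolding H by (intro open_Int open_ball open_halfspace_Im_gt) (intro convex_Int convex_ball convex_halfspace_Im_gt)
    have "S = (\<lambda>z. z - \<i> * of_real (\<eta> k)) ` H" by (force simp: S_def image_def)
    then have convS: "convex S" using convex_translation_subtract[OF openH(2)] by simp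
    have openS: "open S" unfolding S_def by (rule open_vimage[OF openH(1)]) (intro continuous_intros)
    have box: "cbox (Complex (-a) 0) (Complex a a) \<subseteq> S" using inH by (auto simp: S_def)
    define F where "F = (\<lambda>z. g (z + \<i> * of_real (\<eta> k)))"
    have F: "F holomorphic_on S"
      unfolding F_def
      by (rule holomorphic_on_compose_gen[of "\<lambda>z. z + \<i> * of_real (\<eta> k)" _ g H, unfolded o_def])
        (auto intro!: holomorphic_intros g simp: S_def)
    have F': "(\<lambda>z. 1 / F z) holomorphic_on S"
      using gnz by (intro holomorphic_intros F) (auto simp: F_def S_def)
    have wS: "w + \<i> * of_real (\<eta> k) \<in> H"
      by (rule inH) (use a w in \<open>auto simp: in_cbox_complex_iff\<close>)
    have FG: "F (of_real s) = G k s" for s by (simp add: F_def G_def)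
    define A B where "A = integral {-a..a} (\<lambda>s. G k s * of_real (P s))"
      and "B = integral {-a..a} (\<lambda>s. 1 / G k s * of_real (P s))"
    have "cmod (F (Complex x y) - integral {-a..a} (\<lambda>s. F (of_real s) * of_real (y / (pi * ((s - x)\<^sup>2 + y\<^sup>2))))) \<le> 16 * 1 * y / a"
      by (rule rectangle_poisson[OF a xy openS convS box F]) (use g(3) inH in \<open>auto simp: F_def\<close>)
    then have 1: "cmod (F w - A) \<le> 16 * y / a"
      by (simp add: A_def FG P_def wxy)
    have "cmod (1 / F (Complex x y) - integral {-a..a} (\<lambda>s. 1 / F (of_real s) * of_real (y / (pi * ((s - x)\<^sup>2 + y\<^sup>2))))) \<le> 16 * (1 / \<delta>) * y / a"
      by (rule rectangle_poisson[OF a xy openS convS box F'])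
        (use g(2) inH \<delta> in \<open>auto simp: F_def norm_divide intro!: frac_le\<close>)
    then have "cmod (1 / F w - B) \<le> 16 / \<delta> * y / a"
      by (simp add: B_def FG P_def wxy)
    then have 2: "cmod (cnj (1 / F w) - cnj B) \<le> 16 / \<delta> * y / a"
      by (metis complex_cnj_diff complex_mod_cnj)
    have cA: "continuous_on {-a..a} (\<lambda>s. G k s * of_real (P s))"
      by (intro continuous_intros contG contP)
    have cB: "continuous_on {-a..a} (\<lambda>s. cnj (1 / G k s * of_real (P s)))"
      by (intro continuous_intros contG contP) (use Gnz in auto)
    have "A - cnj B = integral {-a..a} (\<lambda>s. G k s * of_real (P s) - cnj (1 / G k s * of_real (P s)))"
      unfolding A_def B_def integral_cnj
      by (rule integral_diff[symmetric]) (intro integrable_continuous_real cA cB)+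
    also have "cmod \<dots> \<le> integral {-a..a} (\<lambda>s. 1 / (\<delta> * (pi * y)) * (1 - (cmod (G k s))\<^sup>2))"
    proof (rule integral_norm_bound_integral)
      show "(\<lambda>s. G k s * of_real (P s) - cnj (1 / G k s * of_real (P s))) integrable_on {-a..a}"
        by (intro integrable_continuous_real continuous_on_diff cA cB)
      show "(\<lambda>s. 1 / (\<delta> * (pi * y)) * (1 - (cmod (G k s))\<^sup>2)) integrable_on {-a..a}"
        by (intro integrable_continuous_real continuous_intros contG)
      fix s assume s: "s \<in> {-a..a}"
      have Gs: "\<delta> \<le> cmod (G k s)" "cmod (G k s) \<le> 1" "G k s \<noteq> 0"
        using g(2,3) inH[OF realbox[OF s]] Gnz[OF s] by (auto simp: G_def)
      have "G k s * of_real (P s) - cnj (1 / G k s * of_real (P s)) = of_real (P s) * ((G k s * cnj (G k s) - 1) / cnj (G k s))"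
        using Gs by (simp add: field_simps)
      also have "cmod \<dots> = P s * ((1 - (cmod (G k s))\<^sup>2) / cmod (G k s))"
      proof -
        have "G k s * cnj (G k s) - 1 = of_real ((cmod (G k s))\<^sup>2 - 1)"
          by (metis complex_norm_square of_real_1 of_real_diff)
        then have "cmod (G k s * cnj (G k s) - 1) = 1 - (cmod (G k s))\<^sup>2"
          using Gs(2) by (simp only: norm_of_real) (simp add: abs_square_le_1)
        then show ?thesis using P(1)[of s] by (simp add: norm_mult norm_divide)
      qed
      also have "\<dots> \<le> (1 / (pi * y)) * ((1 - (cmod (G k s))\<^sup>2) / \<delta>)"
        using P[of s] Gs \<delta> xy by (intro mult_mono frac_le) (auto simp: abs_square_le_1)
      finally show "cmod (G k s * of_real (P s) - cnj (1 / G k s * of_real (P s))) \<le> 1 / (\<delta> * (pi * y)) * (1 - (cmod (G k s))\<^sup>2)"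
        by (simp add: field_simps)
    qed
    also have "\<dots> = 1 / (\<delta> * (pi * y)) * J k" by (simp add: J_def)
    finally have 3: "cmod (A - cnj B) \<le> 1 / (\<delta> * (pi * y)) * J k" .
    have Fw: "\<delta> \<le> cmod (F w)" "cmod (F w) \<le> 1" "F w \<noteq> 0"
      using g(2,3)[OF wS] gnz[OF wS] by (auto simp: F_def)
    have "1 - (cmod (F w))\<^sup>2 \<le> cmod (cnj (1 / F w)) - cmod (F w)"
    proof -
      have pos: "0 < cmod (F w)" using Fw by simp
      have "(1 - (cmod (F w))\<^sup>2) * cmod (F w) \<le> 1 - (cmod (F w))\<^sup>2"
        using Fw by (intro mult_left_le) (auto simp: abs_square_le_1)
      then have "1 - (cmod (F w))\<^sup>2 \<le> (1 - (cmod (F w))\<^sup>2) / cmod (F w)"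
        using pos by (simp add: pos_le_divide_eq)
      also have "\<dots> = 1 / cmod (F w) - cmod (F w)"
        using pos by (simp add: diff_divide_distrib power2_eq_square)
      also have "1 / cmod (F w) = cmod (cnj (1 / F w))"
        by (simp add: norm_divide)
      finally show ?thesis .
    qed
    also have "\<dots> \<le> cmod (cnj (1 / F w) - F w)"
      by (rule norm_triangle_ineq2)
    also have "\<dots> = cmod ((F w - A) + ((A - cnj B) + (cnj B - cnj (1 / F w))))"
      by (simp add: norm_minus_commute)
    also have "\<dots> \<le> cmod (F w - A) + (cmod (A - cnj B) + cmod (cnj B - cnj (1 / F w)))"
      by (rule order_trans[OF norm_triangle_ineq add_left_mono[OF norm_triangle_ineq]])
    also have "\<dots> \<le> 16 * y / a + (1 / (\<delta> * (pi * y)) * J k + 16 / \<delta> * y / a)"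
      using 1 2 3 by (intro add_mono) (auto simp: norm_minus_commute)
    also have "\<dots> = (16 + 16 / \<delta>) / a * y + 1 / (\<delta> * (pi * y)) * J k"
      by (simp add: field_simps add_divide_distrib)
    finally show ?thesis by (simp add: F_def)
  qed
  have wH: "w \<in> H"
  proof -
    have "cmod w \<le> \<bar>Re w\<bar> + \<bar>Im w\<bar>" by (rule cmod_le)
    then show ?thesis using w a by (auto simp: H)
  qed
  have openH: "open H" unfolding H by (intro open_Int open_ball open_halfspace_Im_gt)
  have "(\<lambda>k. w + \<i> * of_real (\<eta> k)) \<longlonglongrightarrow> w + \<i> * of_real 0"
    by (intro tendsto_intros \<eta>lim)
  then have "(\<lambda>k. g (w + \<i> * of_real (\<eta> k))) \<longlonglongrightarrow> g w"
    using isCont_tendsto_compose[of w g "\<lambda>k. w + \<i> * of_real (\<eta> k)" sequentially]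
      holomorphic_on_imp_continuous_on[OF g(1)] openH wH by (simp add: continuous_on_eq_continuous_at)
  then have l: "(\<lambda>k. 1 - (cmod (g (w + \<i> * of_real (\<eta> k))))\<^sup>2) \<longlonglongrightarrow> 1 - (cmod (g w))\<^sup>2"
    by (intro tendsto_intros)
  have "(\<lambda>k. (16 + 16 / \<delta>) / a * y + 1 / (\<delta> * (pi * y)) * J k) \<longlonglongrightarrow> (16 + 16 / \<delta>) / a * y + 1 / (\<delta> * (pi * y)) * integral {-a..a} (\<lambda>s. 0)"
    by (intro tendsto_intros Jlim)
  from LIMSEQ_le[OF l this] bound show ?thesis by (simp add: y_def)
qed

text \<open>
  The definition of an inner function controls one period of the angle, which has the point \<open>1\<close> of the circle
  at its ends; a statement about all angles is needed to work near an arbitrary boundary point.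
\<close>
lemma inner_function_radial_negligible:
  assumes "inner_function u"
  shows "negligible {t. \<not> ((\<lambda>r. cmod (u (of_real r * cis t))) \<longlongrightarrow> 1) (at_left 1)}"
proof -
  define P where "P t \<longleftrightarrow> ((\<lambda>r. cmod (u (of_real r * cis t))) \<longlongrightarrow> 1) (at_left 1)" for t
  have "AE t in lebesgue_on {0..2 * pi}. \<exists>l. ((\<lambda>r. u (of_real r * cis t)) \<longlongrightarrow> l) (at_left 1) \<and> cmod l = 1"
    using assms by (simp add: inner_function_def)
  then have "AE t in lebesgue_on {0..2 * pi}. P t"
  proof eventually_elim
    case (elim t)
    then obtain l where "((\<lambda>r. u (of_real r * cis t)) \<longlongrightarrow> l) (at_left 1)" "cmod l = 1" by blast
    from tendsto_norm[OF this(1)] this(2) show ?case by (simp add: P_def)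
  qed
  then have "AE t in lebesgue. t \<in> {0..2 * pi} \<longrightarrow> P t"
    by (subst (asm) AE_restrict_space_iff) auto
  then obtain N where N: "negligible N" "{t. \<not> (t \<in> {0..2 * pi} \<longrightarrow> P t)} \<subseteq> N"
    unfolding eventually_ae_filter_negligible by blast
  have "negligible (\<Union>m::int. (+) (2 * pi * of_int m) ` N)"
    by (intro negligible_countable_Union) (auto intro: negligible_translation N)
  then have "negligible {t. \<not> P t}"
  proof (rule negligible_subset)
    show "{t. \<not> P t} \<subseteq> (\<Union>m::int. (+) (2 * pi * of_int m) ` N)"
    proof
      fix t assume t: "t \<in> {t. \<not> P t}"
      define m where "m = \<lfloor>t / (2 * pi)\<rfloor>"
      define s where "s = t - 2 * pi * of_int m"
      have "of_int m \<le> t / (2 * pi)" "t / (2 * pi) \<le> of_int m + 1"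
        unfolding m_def by linarith+
      then have s: "s \<in> {0..2 * pi}"
        using pi_gt_zero by (auto simp: s_def field_simps)
      have "cis (s + 2 * pi * of_int m) = cis s"
        unfolding cis_mult[symmetric] using cis_multiple_2pi[of "of_int m"] by simp
      then have "cis t = cis s" by (simp add: s_def)
      then have "\<not> P s" using t by (simp add: P_def)
      then have "s \<in> N" using N(2) s by auto
      moreover have "t = 2 * pi * of_int m + s" by (simp add: s_def)
      ultimately show "t \<in> (\<Union>m::int. (+) (2 * pi * of_int m) ` N)" by blast
    qed
  qed
  then show ?thesis by (simp add: P_def)
qed

text \<open>
  In the coordinate \<open>w\<close> with \<open>z = \<xi> exp (\<i> w)\<close> the circle becomes the real axis and radii become
  vertical lines.
\<close>
lemma kernel_growth_bounded_near:
  assumes u: "inner_function u" and \<xi>: "cmod \<xi> = 1" and \<epsilon>: "0 < \<epsilon>" and \<delta>: "0 < \<delta>"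
    and low: "\<And>z. z \<in> disk \<Longrightarrow> dist z \<xi> < \<epsilon> \<Longrightarrow> \<delta> \<le> cmod (u z)"
  obtains \<rho> C where "0 < \<rho>" "\<And>z. z \<in> disk \<Longrightarrow> dist z \<xi> < \<rho> \<Longrightarrow> kernel_growth u z \<le> C"
proof -
  define \<theta> where "\<theta> = Arg \<xi>"
  have "\<xi> \<noteq> 0" using \<xi> by auto
  then have \<xi>cis: "\<xi> = cis \<theta>" using \<xi> cis_Arg[of \<xi>] by (simp add: \<theta>_def sgn_div_norm)
  have "((\<lambda>w. exp (\<i> * w)) \<longlongrightarrow> exp (\<i> * 0)) (at 0)" by (intro tendsto_intros)
  then obtain d where d: "0 < d" "\<And>w. w \<noteq> 0 \<Longrightarrow> dist w 0 < d \<Longrightarrow> dist (exp (\<i> * w)) 1 < \<epsilon>"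
    using \<epsilon> unfolding Lim_at by (metis exp_zero mult_zero_right zero_less_dist_iff)
  define a where "a = d / 4"
  have a: "0 < a" using d by (simp add: a_def)
  define H where "H = ball 0 (4 * a) \<inter> {z. 0 < Im z}"
  define g where "g = (\<lambda>w. u (\<xi> * exp (\<i> * w)))"
  have arg: "\<xi> * exp (\<i> * w) \<in> disk" "dist (\<xi> * exp (\<i> * w)) \<xi> < \<epsilon>" if "w \<in> H" for w
  proof -
    show "\<xi> * exp (\<i> * w) \<in> disk" using that \<xi> by (simp add: H_def norm_mult)
    have "dist (\<xi> * exp (\<i> * w)) \<xi> = cmod (\<xi> * (exp (\<i> * w) - 1))"
      by (simp add: dist_norm right_diff_distrib)
    also have "\<dots> = dist (exp (\<i> * w)) 1" using \<xi> by (simp add: norm_mult dist_norm)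
    also have "\<dots> < \<epsilon>" using that by (intro d(2)) (auto simp: H_def a_def)
    finally show "dist (\<xi> * exp (\<i> * w)) \<xi> < \<epsilon>" .
  qed
  have g: "g holomorphic_on H"
    unfolding g_def
    by (rule holomorphic_on_compose_gen[of "\<lambda>w. \<xi> * exp (\<i> * w)" H u disk, unfolded o_def])
      (use arg in \<open>auto intro!: holomorphic_intros inner_function_holomorphic[OF u]\<close>)
  have g1: "\<delta> \<le> cmod (g w)" "cmod (g w) \<le> 1" if "w \<in> H" for w
    using low[OF arg[OF that]] inner_function_le_one[OF u arg(1)[OF that]] by (auto simp: g_def)
  define N where "N = {t. \<not> ((\<lambda>r. cmod (u (of_real r * cis t))) \<longlongrightarrow> 1) (at_left 1)}"
  have "negligible ((+) (-\<theta>) ` N)"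
    unfolding N_def by (intro negligible_translation inner_function_radial_negligible u)
  moreover have "{s. \<not> ((\<lambda>\<eta>. cmod (g (Complex s \<eta>))) \<longlongrightarrow> 1) (at_right 0)} \<subseteq> (+) (-\<theta>) ` N"
  proof
    fix s assume s: "s \<in> {s. \<not> ((\<lambda>\<eta>. cmod (g (Complex s \<eta>))) \<longlongrightarrow> 1) (at_right 0)}"
    have "g (Complex s \<eta>) = u (of_real (exp (-\<eta>)) * cis (\<theta> + s))" for \<eta>
    proof -
      have "exp (\<i> * Complex s \<eta>) = of_real (exp (-\<eta>)) * cis s"
        by (simp add: exp_eq_polar)
      then show ?thesis unfolding g_def \<xi>cis by (simp add: cis_mult[symmetric] mult_ac)
    qed
    moreover have "filterlim (\<lambda>\<eta>. exp (-\<eta>)) (at_left 1) (at_right (0::real))"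
    proof -
      have "((\<lambda>\<eta>::real. exp (-\<eta>)) \<longlongrightarrow> exp (-0)) (at_right 0)" by (intro tendsto_intros)
      moreover have "\<forall>\<^sub>F \<eta>::real in at_right 0. exp (-\<eta>) \<in> {..<1} \<and> exp (-\<eta>) \<noteq> 1"
        using eventually_at_right_less[of "0::real"] by eventually_elim auto
      ultimately show ?thesis unfolding filterlim_at by simp
    qed
    ultimately have "\<theta> + s \<in> N"
      using s filterlim_compose[of "\<lambda>r. cmod (u (of_real r * cis (\<theta> + s)))" "nhds 1" "at_left 1" "\<lambda>\<eta>. exp (-\<eta>)" "at_right 0"]
      by (auto simp: N_def)
    moreover have "s = -\<theta> + (\<theta> + s)" by simp
    ultimately show "s \<in> (+) (-\<theta>) ` N" by blast
  qed
  ultimately have "AE s in lebesgue. ((\<lambda>\<eta>. cmod (g (Complex s \<eta>))) \<longlongrightarrow> 1) (at_right 0)"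
    unfolding eventually_ae_filter_negligible by blast
  then have lim: "AE s in lebesgue_on {-a..a}. ((\<lambda>\<eta>. cmod (g (Complex s \<eta>))) \<longlongrightarrow> 1) (at_right 0)"
    by (subst AE_restrict_space_iff) auto
  have "((\<lambda>z. Ln (z / \<xi>)) \<longlongrightarrow> Ln (\<xi> / \<xi>)) (at \<xi>)"
    using \<xi> by (intro tendsto_intros) auto
  then obtain \<rho>' where \<rho>': "0 < \<rho>'" "\<And>z. z \<noteq> \<xi> \<Longrightarrow> dist z \<xi> < \<rho>' \<Longrightarrow> dist (Ln (z / \<xi>)) 0 < a / 2"
    using a \<xi> unfolding Lim_at by (metis Ln_1 divide_self half_gt_zero norm_zero zero_less_dist_iff zero_neq_one)
  show ?thesis
  proof (rule that)
    show "0 < min \<rho>' (1 / 2)" using \<rho>' by simp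
    fix z assume z: "z \<in> disk" "dist z \<xi> < min \<rho>' (1 / 2)"
    have zn: "1 / 2 \<le> cmod z" "cmod z < 1"
      using z norm_triangle_ineq2[of \<xi> z] \<xi> by (auto simp: dist_norm norm_minus_commute)
    then have nz: "z \<noteq> 0" "\<xi> \<noteq> 0" "z \<noteq> \<xi>" using \<xi> by auto
    define w where "w = - \<i> * Ln (z / \<xi>)"
    have wn: "cmod w < a / 2" using \<rho>'(2)[OF nz(3)] z by (simp add: w_def norm_mult)
    have "exp (\<i> * w) = z / \<xi>" using nz by (simp add: w_def mult.assoc[symmetric])
    then have gw: "g w = u z" using nz by (simp add: g_def)
    have Imw: "Im w = - ln (cmod z)" using nz \<xi> by (simp add: w_def norm_divide)
    have w: "\<bar>Re w\<bar> \<le> a / 2" "0 < Im w" "Im w \<le> a / 2"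
      using abs_Re_le_cmod[of w] abs_Im_le_cmod[of w] wn zn ln_less_zero[of "cmod z"] nz
      unfolding Imw by auto
    define K where "K = (16 + 16 / \<delta>) / a"
    have K: "0 \<le> K" using a \<delta> by (simp add: K_def)
    have "1 - (cmod (u z))\<^sup>2 \<le> K * Im w"
      using reflection_estimate[OF a \<delta> H_def g g1 lim w] by (simp add: gw K_def)
    also have "Im w \<le> 2 * (1 - (cmod z)\<^sup>2)"
    proof -
      have "Im w = ln (1 / cmod z)" using zn by (simp add: Imw ln_div)
      also have "\<dots> \<le> 1 / cmod z - 1" using zn by (intro ln_le_minus_one) auto
      also have "\<dots> = (1 - cmod z) / cmod z" using zn nz by (simp add: diff_divide_distrib)
      also have "\<dots> \<le> (1 - cmod z) / (1 / 2)" using zn by (intro divide_left_mono) auto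
      also have "\<dots> \<le> 2 * (1 - (cmod z)\<^sup>2)"
        using zn mult_left_le[of "cmod z" "cmod z"] by (simp add: power2_eq_square)
      finally show ?thesis .
    qed
    then have "K * Im w \<le> K * (2 * (1 - (cmod z)\<^sup>2))" by (rule mult_left_mono[OF _ K])
    finally have "1 - (cmod (u z))\<^sup>2 \<le> (2 * K) * (1 - (cmod z)\<^sup>2)" by (simp add: algebra_simps)
    moreover have "0 < 1 - (cmod z)\<^sup>2" using zn by (simp add: abs_square_less_1)
    ultimately show "kernel_growth u z \<le> 2 * K"
      by (simp add: kernel_growth_def pos_divide_le_eq)
  qed
qed

lemma not_in_boundary_spectrum:
  assumes "\<xi> \<in> sphere 0 1" "\<xi> \<notin> boundary_spectrum u"
  obtains \<epsilon> \<delta> where "0 < \<epsilon>" "0 < \<delta>" "\<And>z. z \<in> disk \<Longrightarrow> dist z \<xi> < \<epsilon> \<Longrightarrow> \<delta> \<le> cmod (u z)"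
proof -
  let ?L = "Liminf (at \<xi> within disk) (\<lambda>z. ereal (cmod (u z)))"
  have "0 \<le> ?L" by (rule Liminf_bounded) (simp add: always_eventually)
  moreover have "?L \<noteq> 0" using assms by (simp add: boundary_spectrum_def)
  ultimately have "0 < ?L" by simp
  then obtain \<delta> where \<delta>: "0 < ereal \<delta>" "ereal \<delta> < ?L" using ereal_dense2 by blast
  from less_LiminfD[OF \<delta>(2)] obtain \<epsilon> where "0 < \<epsilon>"
    "\<And>z. z \<in> disk \<Longrightarrow> z \<noteq> \<xi> \<Longrightarrow> dist z \<xi> < \<epsilon> \<Longrightarrow> \<delta> < cmod (u z)"
    unfolding eventually_at by auto
  moreover have "\<xi> \<notin> disk" using assms by auto
  ultimately show ?thesis using \<delta> by (intro that[of \<epsilon> \<delta>]) (auto intro: less_imp_le)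
qed

lemma kernel_growth_le:
  assumes "z \<in> disk"
  shows "kernel_growth \<Theta> z \<le> 1 / (1 - (cmod z)\<^sup>2)"
  using assms by (simp add: kernel_growth_def divide_right_mono abs_square_le_1)

text \<open>
  Near a boundary point outside the spectrum of \<open>u\<close> or of \<open>I\<close> that function is bounded below, so the
  growth of \<open>u\<close> or of \<open>z I(z)\<close> is bounded there; close to the circle the factor \<open>z\<close> costs at most a factor \<open>1/2\<close>. Near an interior
  point both are bounded. Compactness of the closed disk makes this uniform.
\<close>
lemma kernel_growths_not_both_large:
  assumes u: "inner_function u" and I: "inner_function I"
    and disj: "boundary_spectrum u \<inter> boundary_spectrum I = {}"
  obtains C where "\<And>z. z \<in> disk \<Longrightarrow> kernel_growth u z \<le> C \<or> kernel_growth (\<lambda>z. z * I z) z \<le> C"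
proof -
  let ?\<Theta> = "\<lambda>z. z * I z"
  note \<Theta> = inner_function_mult[OF inner_function_id I]
  have growth_near: "\<exists>\<rho> C. 0 < \<rho> \<and> (\<forall>z\<in>disk. dist z \<xi> < \<rho> \<longrightarrow> kernel_growth u z \<le> C \<or> kernel_growth ?\<Theta> z \<le> C)"
    if "\<xi> \<in> cball 0 1" for \<xi>
  proof (cases "cmod \<xi> = 1")
    case True
    then have s: "\<xi> \<in> sphere 0 1" by simp
    show ?thesis
    proof (cases "\<xi> \<in> boundary_spectrum u")
      case False
      obtain \<epsilon> \<delta> where "0 < \<epsilon>" "0 < \<delta>" "\<And>z. z \<in> disk \<Longrightarrow> dist z \<xi> < \<epsilon> \<Longrightarrow> \<delta> \<le> cmod (u z)"
        using not_in_boundary_spectrum[OF s False] by blast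
      from kernel_growth_bounded_near[OF u True this] show ?thesis by metis
    next
      case True
      then have "\<xi> \<notin> boundary_spectrum I" using disj by blast
      then obtain \<epsilon> \<delta> where e: "0 < \<epsilon>" "0 < \<delta>" "\<And>z. z \<in> disk \<Longrightarrow> dist z \<xi> < \<epsilon> \<Longrightarrow> \<delta> \<le> cmod (I z)"
        using not_in_boundary_spectrum[OF s] by blast
      have "\<delta> / 2 \<le> cmod (z * I z)" if z: "z \<in> disk" "dist z \<xi> < min \<epsilon> (1 / 2)" for z
      proof -
        have "1 / 2 \<le> cmod z"
          using z norm_triangle_ineq2[of \<xi> z] s by (auto simp: dist_norm norm_minus_commute)
        then have "1 / 2 * \<delta> \<le> cmod z * cmod (I z)"
          using e z by (intro mult_mono) auto
        then show ?thesis by (simp add: norm_mult)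
      qed
      moreover have "0 < min \<epsilon> (1 / 2)" "0 < \<delta> / 2" using e by auto
      moreover have "cmod \<xi> = 1" using s by simp
      ultimately show ?thesis using kernel_growth_bounded_near[OF \<Theta>, of \<xi> "min \<epsilon> (1 / 2)" "\<delta> / 2"] by metis
    qed
  next
    case False
    define s where "s = (1 + cmod \<xi>) / 2"
    have s: "cmod \<xi> < s" "s < 1" "0 \<le> s" using that False by (auto simp: s_def)
    have "kernel_growth u z \<le> 1 / (1 - s\<^sup>2)" if z: "z \<in> disk" "dist z \<xi> < s - cmod \<xi>" for z
    proof -
      have "cmod z \<le> s" using z norm_triangle_ineq2[of z \<xi>] by (simp add: dist_norm)
      then have "(cmod z)\<^sup>2 \<le> s\<^sup>2" by (intro power_mono) auto
      moreover have "s\<^sup>2 < 1" using s by (simp add: abs_square_less_1)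
      ultimately have "1 / (1 - (cmod z)\<^sup>2) \<le> 1 / (1 - s\<^sup>2)" by (intro divide_left_mono) auto
      then show ?thesis using kernel_growth_le[OF z(1), of u] by simp
    qed
    then show ?thesis using s by (intro exI[of _ "s - cmod \<xi>"] exI[of _ "1 / (1 - s\<^sup>2)"]) auto
  qed
  have "\<exists>C. \<forall>z\<in>disk. kernel_growth u z \<le> C \<or> kernel_growth ?\<Theta> z \<le> C"
  proof (rule ccontr)
    assume "\<nexists>C. \<forall>z\<in>disk. kernel_growth u z \<le> C \<or> kernel_growth ?\<Theta> z \<le> C"
    then have "\<forall>n::nat. \<exists>z\<in>disk. kernel_growth u z > real n \<and> kernel_growth ?\<Theta> z > real n"
      by (metis not_le)
    then obtain z where z: "\<And>n::nat. z n \<in> disk" "\<And>n. kernel_growth u (z n) > real n" "\<And>n. kernel_growth ?\<Theta> (z n) > real n"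
      by metis
    have "\<forall>n. z n \<in> cball 0 1" using z(1) ball_subset_cball by blast
    then obtain \<xi> r where \<xi>: "\<xi> \<in> cball 0 1" "strict_mono r" "(z \<circ> r) \<longlonglongrightarrow> \<xi>"
      using compact_cball[of "0::complex" 1] unfolding compact_def by metis
    obtain \<rho> C where \<rho>: "0 < \<rho>" "\<forall>z\<in>disk. dist z \<xi> < \<rho> \<longrightarrow> kernel_growth u z \<le> C \<or> kernel_growth ?\<Theta> z \<le> C"
      using growth_near[OF \<xi>(1)] by blast
    have "\<forall>\<^sub>F n in sequentially. dist ((z \<circ> r) n) \<xi> < \<rho>"
      using tendstoD[OF \<xi>(3) \<rho>(1)] .
    moreover have "\<forall>\<^sub>F n in sequentially. C \<le> real n"
      using eventually_ge_at_top[of "nat \<lceil>C\<rceil>"] by eventually_elim linarith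
    ultimately have "\<forall>\<^sub>F n in sequentially. dist (z (r n)) \<xi> < \<rho> \<and> C \<le> real n"
      by eventually_elim simp
    then obtain n where n: "dist (z (r n)) \<xi> < \<rho>" "C \<le> real n"
      unfolding eventually_sequentially by blast
    have "real n \<le> real (r n)" using seq_suble[OF \<xi>(2)] by simp
    then show False using \<rho>(2) n z[of "r n"] by fastforce
  qed
  then show ?thesis using that by blast
qed

section \<open>Inner functions bounded away from zero near the circle\<close>

definition blaschke_factor :: "complex \<Rightarrow> complex \<Rightarrow> complex" where
  "blaschke_factor a z = (z - a) / (1 - cnj a * z)"

lemma blaschke_factor_cmod:
  assumes "a \<in> disk" "z \<in> disk"
  shows "1 - (cmod (blaschke_factor a z))\<^sup>2 = (1 - (cmod a)\<^sup>2) * (1 - (cmod z)\<^sup>2) / (cmod (1 - cnj a * z))\<^sup>2"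
proof -
  have "of_real ((cmod (1 - cnj a * z))\<^sup>2 - (cmod (z - a))\<^sup>2) = (of_real ((1 - (cmod a)\<^sup>2) * (1 - (cmod z)\<^sup>2)) :: complex)"
    unfolding of_real_diff of_real_mult of_real_1 complex_norm_square by (simp add: algebra_simps)
  then have "(cmod (1 - cnj a * z))\<^sup>2 - (cmod (z - a))\<^sup>2 = (1 - (cmod a)\<^sup>2) * (1 - (cmod z)\<^sup>2)"
    unfolding of_real_eq_iff .
  moreover have "1 - cnj a * z \<noteq> 0" by (rule szego_denominator_bound[OF assms])
  ultimately show ?thesis
    by (simp add: blaschke_factor_def norm_divide power_divide field_simps)
qed

lemma blaschke_factor_le_one:
  assumes "a \<in> disk" "z \<in> disk"
  shows "cmod (blaschke_factor a z) \<le> 1"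
proof -
  have "0 \<le> (1 - (cmod a)\<^sup>2) * (1 - (cmod z)\<^sup>2) / (cmod (1 - cnj a * z))\<^sup>2"
    using assms by (intro divide_nonneg_nonneg mult_nonneg_nonneg) (auto simp: abs_square_le_1)
  then have "(cmod (blaschke_factor a z))\<^sup>2 \<le> 1" using blaschke_factor_cmod[OF assms] by simp
  then show ?thesis by (simp add: abs_square_le_1)
qed

lemma norm_prod_list_le:
  fixes f :: "'a \<Rightarrow> complex"
  assumes "\<And>a. a \<in> set as \<Longrightarrow> cmod (f a) \<le> q" "0 \<le> q"
  shows "cmod (\<Prod>a\<leftarrow>as. f a) \<le> q ^ length as"
  using assms(1)
proof (induction as)
  case (Cons a as)
  then show ?case using assms(2) by (auto simp: norm_mult intro!: mult_mono)
qed simp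

text \<open>
  Removing the zero keeps the function inner because a Blaschke factor is unimodular on the circle and
  bounded away from \<open>0\<close> near it.
\<close>
lemma inner_function_divide_blaschke_factor:
  assumes g: "inner_function g" and a: "a \<in> disk" "g a = 0"
  obtains h where "inner_function h" "\<And>z. z \<in> disk \<Longrightarrow> g z = blaschke_factor a z * h z"
proof -
  define q where "q = (\<lambda>z. if z = a then deriv g a else g z / (z - a))"
  have q: "q holomorphic_on disk"
    using pole_theorem_open_0[OF inner_function_holomorphic[OF g] open_ball, of a q] a by (simp add: q_def)
  define h where "h = (\<lambda>z. (1 - cnj a * z) * q z)"
  have h: "h holomorphic_on disk" unfolding h_def by (intro holomorphic_intros q)
  have eq: "g z = blaschke_factor a z * h z" if "z \<in> disk" for z
    using szego_denominator_bound(2)[OF a(1) that] a by (simp add: blaschke_factor_def h_def q_def)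
  define s where "s = (1 + cmod a) / 2"
  have s: "cmod a < s" "s < 1" "0 \<le> s" using a by (auto simp: s_def)
  have "compact (h ` cball 0 s)"
    by (intro compact_continuous_image continuous_on_subset[OF holomorphic_on_imp_continuous_on[OF h]]) (use s in auto)
  from compact_imp_bounded[OF this] obtain B where "\<forall>x\<in>h ` cball 0 s. cmod x \<le> B"
    unfolding bounded_iff by blast
  then have B: "cmod (h z) \<le> B" if "z \<in> cball 0 s" for z using that by blast
  have bd: "cmod (h z) \<le> max B (2 / (s - cmod a))" if z: "z \<in> disk" for z
  proof (cases "cmod z \<le> s")
    case True
    then show ?thesis using B[of z] by (simp add: le_max_iff_disj)
  next
    case False
    then have "s - cmod a \<le> cmod (z - a)" using norm_triangle_ineq2[of z a] by simp
    moreover have "z \<noteq> a" using False s by auto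
    moreover have "cmod (1 - cnj a * z) \<le> 1 + cmod a * cmod z"
      using norm_triangle_ineq4[of 1 "cnj a * z"] by (simp add: norm_mult)
    then have "cmod (1 - cnj a * z) \<le> 2"
      using mult_le_one[of "cmod a" "cmod z"] a z by simp
    moreover have "cmod (g z) \<le> 1" by (rule inner_function_le_one[OF g z])
    ultimately have "cmod (1 - cnj a * z) * cmod (g z) / cmod (z - a) \<le> 2 * 1 / (s - cmod a)"
      using s by (intro frac_le mult_mono) auto
    then show ?thesis using \<open>z \<noteq> a\<close> by (simp add: h_def q_def norm_mult norm_divide le_max_iff_disj)
  qed
  have "inner_function h"
    unfolding inner_function_def
  proof (intro conjI h)
    show "bounded (h ` disk)" unfolding bounded_iff using bd by blast
    have "AE t in lebesgue_on {0..2 * pi}. \<exists>l. ((\<lambda>r. g (of_real r * cis t)) \<longlongrightarrow> l) (at_left 1) \<and> cmod l = 1"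
      using g by (simp add: inner_function_def)
    then show "AE t in lebesgue_on {0..2 * pi}. \<exists>l. ((\<lambda>r. h (of_real r * cis t)) \<longlongrightarrow> l) (at_left 1) \<and> cmod l = 1"
    proof eventually_elim
      case (elim t)
      then obtain l where l: "((\<lambda>r. g (of_real r * cis t)) \<longlongrightarrow> l) (at_left 1)" "cmod l = 1" by blast
      let ?c = "cis t"
      have ca: "?c - a \<noteq> 0" using a by auto
      have "?c * cnj (?c - a) = 1 - cnj a * ?c"
        by (simp add: algebra_simps flip: complex_norm_square)
      then have n: "cmod (1 - cnj a * ?c) = cmod (?c - a)"
        by (metis complex_mod_cnj mult_1 norm_cis norm_mult)
      have "((\<lambda>r. (1 - cnj a * (of_real r * ?c)) * (g (of_real r * ?c) / (of_real r * ?c - a)))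
          \<longlongrightarrow> (1 - cnj a * (of_real 1 * ?c)) * (l / (of_real 1 * ?c - a))) (at_left 1)"
        using ca by (intro tendsto_intros l) auto
      moreover have "\<forall>\<^sub>F r in at_left 1. h (of_real r * ?c) = (1 - cnj a * (of_real r * ?c)) * (g (of_real r * ?c) / (of_real r * ?c - a))"
      proof -
        have "\<forall>\<^sub>F r in at_left (1::real). r \<in> {cmod a<..<1}"
          using a by (intro eventually_at_left_real) auto
        then show ?thesis
        proof eventually_elim
          case (elim r)
          then have "cmod (of_real r * ?c) \<noteq> cmod a"
            using order_trans[OF norm_ge_zero[of a], of r] by (auto simp: norm_mult)
          then show ?case by (auto simp: h_def q_def)
        qed
      qed
      ultimately have "((\<lambda>r. h (of_real r * ?c)) \<longlongrightarrow> (1 - cnj a * (of_real 1 * ?c)) * (l / (of_real 1 * ?c - a))) (at_left 1)"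
        using tendsto_cong by fastforce
      moreover have "cmod ((1 - cnj a * (of_real 1 * ?c)) * (l / (of_real 1 * ?c - a))) = 1"
        using n l(2) ca by (simp add: norm_mult norm_divide)
      ultimately show ?case by blast
    qed
  qed
  from that[OF this eq] show ?thesis .
qed

text \<open>
  The reciprocal is inner as well, so both are bounded by \<open>1\<close>.
\<close>
lemma inner_function_bounded_below_constant:
  assumes g: "inner_function g" and m: "0 < m" "\<And>z. z \<in> disk \<Longrightarrow> m \<le> cmod (g z)"
  obtains c where "cmod c = 1" "\<And>z. z \<in> disk \<Longrightarrow> g z = c"
proof -
  have nz: "g z \<noteq> 0" if "z \<in> disk" for z using m that by fastforce
  have inv: "inner_function (\<lambda>z. 1 / g z)"
    unfolding inner_function_def
  proof (intro conjI)
    show "(\<lambda>z. 1 / g z) holomorphic_on disk"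
      by (intro holomorphic_intros inner_function_holomorphic g nz)
    have "cmod (1 / g z) \<le> 1 / m" if "z \<in> disk" for z
      using m(1) m(2)[OF that] by (simp add: norm_divide frac_le)
    then show "bounded ((\<lambda>z. 1 / g z) ` disk)" unfolding bounded_iff by blast
    have "AE t in lebesgue_on {0..2 * pi}. \<exists>l. ((\<lambda>r. g (of_real r * cis t)) \<longlongrightarrow> l) (at_left 1) \<and> cmod l = 1"
      using g by (simp add: inner_function_def)
    then show "AE t in lebesgue_on {0..2 * pi}. \<exists>l. ((\<lambda>r. 1 / g (of_real r * cis t)) \<longlongrightarrow> l) (at_left 1) \<and> cmod l = 1"
    proof eventually_elim
      case (elim t)
      then obtain l where l: "((\<lambda>r. g (of_real r * cis t)) \<longlongrightarrow> l) (at_left 1)" "cmod l = 1" by blast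
      then have "((\<lambda>r. 1 / g (of_real r * cis t)) \<longlongrightarrow> 1 / l) (at_left 1)"
        by (intro tendsto_intros) auto
      then show ?case using l(2) by (intro exI[of _ "1 / l"]) (simp add: norm_divide)
    qed
  qed
  have one: "cmod (g z) = 1" if "z \<in> disk" for z
    using inner_function_le_one[OF g that] inner_function_le_one[OF inv that] nz[OF that]
    by (simp add: norm_divide)
  have "g constant_on disk"
    using inner_function_less_one[OF g, of 0] one[of 0] by fastforce
  then obtain c where "\<And>z. z \<in> disk \<Longrightarrow> g z = c" unfolding constant_on_def by blast
  with one[of 0] show ?thesis by (intro that[of c]) auto
qed

text \<open>
  All zeros lie in a compact part of the disk, where each Blaschke factor is at most some \<open>q < 1\<close> at
  a fixed point; since the quotients remain bounded by \<open>1\<close>, only finitely many factors can be split off.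
  The quotient by a maximal product has no zeros, so it is bounded below, hence constant.
\<close>
lemma finite_blaschke_product_if_bounded_below:
  assumes I: "inner_function I" and r: "0 < r" "r < 1" and m: "0 < m"
    and low: "\<And>z. z \<in> disk \<Longrightarrow> r \<le> cmod z \<Longrightarrow> m \<le> cmod (I z)"
  shows "finite_blaschke_product I"
proof -
  define Q where "Q n \<longleftrightarrow> (\<exists>as g. length as = n \<and> set as \<subseteq> disk \<and> inner_function g \<and>
      (\<forall>z\<in>disk. I z = (\<Prod>a\<leftarrow>as. blaschke_factor a z) * g z))" for n
  define q where "q = sqrt (1 - (1 - r\<^sup>2) * (1 - r\<^sup>2) / 4)"
  have r2: "0 < 1 - r\<^sup>2" "1 - r\<^sup>2 \<le> 1" using r by (auto simp: abs_square_less_1)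
  have "(1 - r\<^sup>2) * (1 - r\<^sup>2) \<le> 1" using r2 by (intro mult_le_one) auto
  then have q: "0 \<le> q" "q < 1" "q\<^sup>2 = 1 - (1 - r\<^sup>2) * (1 - r\<^sup>2) / 4"
    using r2 mult_pos_pos[OF r2(1) r2(1)] by (auto simp: q_def intro!: real_sqrt_lt_1_iff[THEN iffD2])
  let ?z = "complex_of_real r"
  have zd: "?z \<in> disk" and zr: "cmod ?z = r" using r by auto
  have bound: "m \<le> q ^ n" if "Q n" for n
  proof -
    from that obtain as g where as: "length as = n" "set as \<subseteq> disk" "inner_function g"
      "\<forall>z\<in>disk. I z = (\<Prod>a\<leftarrow>as. blaschke_factor a z) * g z" unfolding Q_def by blast
    have fac: "cmod (blaschke_factor a ?z) \<le> q" if a: "a \<in> set as" for a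
    proof -
      have ad: "a \<in> disk" using a as by blast
      have "blaschke_factor a a = 0" by (simp add: blaschke_factor_def)
      then have "(\<Prod>b\<leftarrow>as. blaschke_factor b a) = 0"
        using a by (auto simp: prod_list_zero_iff)
      then have "I a = 0" using as(4) ad by simp
      then have "cmod a < r" using low[OF ad] m by fastforce
      then have "(cmod a)\<^sup>2 \<le> r\<^sup>2" by (intro power_mono) auto
      then have num: "(1 - r\<^sup>2) * (1 - r\<^sup>2) \<le> (1 - (cmod a)\<^sup>2) * (1 - (cmod ?z)\<^sup>2)"
        unfolding zr using r2 by (intro mult_right_mono) auto
      have "cmod (1 - cnj a * ?z) \<le> 1 + cmod a * cmod ?z"
        using norm_triangle_ineq4[of 1 "cnj a * ?z"] by (simp only: norm_mult norm_one complex_mod_cnj)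
      also have "\<dots> \<le> 2" using mult_le_one[of "cmod a" "cmod ?z"] ad zd by simp
      finally have "(cmod (1 - cnj a * ?z))\<^sup>2 \<le> 2\<^sup>2" by (intro power_mono) auto
      moreover have "0 < (cmod (1 - cnj a * ?z))\<^sup>2"
        using szego_denominator_bound(2)[OF ad zd] by simp
      ultimately have "(1 - r\<^sup>2) * (1 - r\<^sup>2) / 4 \<le> (1 - (cmod a)\<^sup>2) * (1 - (cmod ?z)\<^sup>2) / (cmod (1 - cnj a * ?z))\<^sup>2"
        using num by (intro frac_le order_trans[OF zero_le_square num]) auto
      then have "(cmod (blaschke_factor a ?z))\<^sup>2 \<le> q\<^sup>2"
        unfolding q(3) using blaschke_factor_cmod[OF ad zd] by linarith
      then show ?thesis using q(1) by (rule power2_le_imp_le)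
    qed
    have "m \<le> cmod (I ?z)" using low[OF zd] zr by simp
    also have "\<dots> = cmod (\<Prod>a\<leftarrow>as. blaschke_factor a ?z) * cmod (g ?z)"
      using as(4) zd by (simp only: norm_mult)
    also have "\<dots> \<le> q ^ length as * 1"
      using norm_prod_list_le[OF fac q(1)] inner_function_le_one[OF as(3) zd] q(1)
      by (intro mult_mono) auto
    finally show ?thesis using as(1) by simp
  qed
  obtain N where N: "q ^ N < m" using real_arch_pow_inv[OF m q(2)] by blast
  have le: "n \<le> N" if "Q n" for n
  proof (rule ccontr)
    assume "\<not> n \<le> N"
    then have "q ^ n \<le> q ^ N" using q by (intro power_decreasing) auto
    with bound[OF that] N show False by simp
  qed
  have "Q 0" unfolding Q_def using I by (auto intro!: exI[of _ I])
  from GreatestI_nat[of Q, OF this] Greatest_le_nat[of Q] le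
  have max: "Q (Greatest Q)" "\<not> Q (Suc (Greatest Q))"
    by (blast, metis Suc_n_not_le_n)
  from max(1) obtain as g where as: "length as = Greatest Q" "set as \<subseteq> disk" and g: "inner_function g"
    and eq: "\<And>z. z \<in> disk \<Longrightarrow> I z = (\<Prod>a\<leftarrow>as. blaschke_factor a z) * g z" unfolding Q_def by blast
  have nz: "g a \<noteq> 0" if a: "a \<in> disk" for a
  proof
    assume "g a = 0"
    from inner_function_divide_blaschke_factor[OF g a this] obtain h where
      h: "inner_function h" "\<And>z. z \<in> disk \<Longrightarrow> g z = blaschke_factor a z * h z" by blast
    have "Q (Suc (length as))"
      unfolding Q_def
      by (rule exI[of _ "a # as"], rule exI[of _ h]) (use as(2) a h eq in \<open>simp add: mult_ac\<close>)
    with max(2) as(1) show False by simp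
  qed
  have gI: "cmod (I z) \<le> cmod (g z)" if "z \<in> disk" for z
  proof -
    have "cmod (\<Prod>a\<leftarrow>as. blaschke_factor a z) \<le> 1 ^ length as"
      by (rule norm_prod_list_le) (use as(2) that blaschke_factor_le_one in auto)
    then show ?thesis using eq[OF that] by (simp add: norm_mult mult_right_le_one_le mult_left_le_one_le)
  qed
  have "continuous_on (cball 0 r) (\<lambda>z. cmod (g z))"
    by (intro continuous_intros continuous_on_subset[OF holomorphic_on_imp_continuous_on[OF inner_function_holomorphic[OF g]]])
      (use r in auto)
  from continuous_attains_inf[OF compact_cball _ this] r obtain x where
    x: "x \<in> cball 0 r" "\<And>z. z \<in> cball 0 r \<Longrightarrow> cmod (g x) \<le> cmod (g z)" by force
  have "x \<in> disk" using x(1) r by auto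
  then have gx: "0 < cmod (g x)" using nz by simp
  have "min m (cmod (g x)) \<le> cmod (g z)" if "z \<in> disk" for z
    using x(2)[of z] low[OF that] gI[OF that] by (cases "cmod z \<le> r") auto
  from inner_function_bounded_below_constant[OF g _ this] gx m obtain c where
    c: "cmod c = 1" "\<And>z. z \<in> disk \<Longrightarrow> g z = c" by auto
  show ?thesis
    unfolding finite_blaschke_product_def
    by (rule exI[of _ c], rule exI[of _ as]) (use as c eq in \<open>auto simp: blaschke_factor_def mult.commute\<close>)
qed

section \<open>Unbounded elements of model spaces\<close>

lemma hardy2_from_coeffs:
  assumes B: "\<And>N. (\<Sum>n<N. (cmod (b n))\<^sup>2) \<le> B"
  obtains f where "f \<in> hardy2" "\<And>n. taylor_coeff f n = b n" "(h2norm f)\<^sup>2 \<le> B"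
proof -
  have le: "(\<Sum>n\<le>N. (cmod (b n))\<^sup>2) \<le> B" for N
    using B[of "Suc N"] unfolding lessThan_Suc_atMost .
  have sq: "summable (\<lambda>n. (cmod (b n))\<^sup>2)"
    by (rule bounded_imp_summable[OF _ le]) simp
  have bn: "cmod (b n) \<le> sqrt B" for n
  proof -
    have "(cmod (b n))\<^sup>2 \<le> (\<Sum>k\<le>n. (cmod (b k))\<^sup>2)"
      by (rule member_le_sum) auto
    then show ?thesis using le[of n] by (intro real_le_rsqrt) simp
  qed
  define f where "f = (\<lambda>z. \<Sum>n. b n * z ^ n)"
  have s: "(\<lambda>n. b n * z ^ n) sums f z" if "z \<in> disk" for z
  proof -
    have "summable (\<lambda>n. sqrt B * cmod z ^ n)"
      using that by (intro summable_mult summable_geometric) simp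
    then have "summable (\<lambda>n. b n * z ^ n)"
      by (rule summable_comparison_test'[where N = 0])
        (simp add: norm_mult norm_power bn mult_right_mono)
    then show ?thesis unfolding f_def by (rule summable_sums)
  qed
  note tc = taylor_coeff_unique[OF s]
  have f: "f \<in> hardy2" using tc sq by (simp add: hardy2_def)
  have "(h2norm f)\<^sup>2 \<le> B"
    using suminf_le_const[OF sq B] sums_unique[OF h2norm_sums[OF f]] tc(2) by simp
  with f tc(2) show ?thesis by (intro that) auto
qed

text \<open>
  The rate \<open>1/3\<close> leaves a tail \<open>3/2 (1/3)\<^sup>n\<close>, of which the part after step \<open>n\<close> is half of the step
  itself. The gliding hump below depends on this ratio being less than \<open>1\<close>.
\<close>
lemma hardy2_complete:
  assumes X: "\<And>n. X n \<in> hardy2" and step: "\<And>n. h2norm (\<lambda>z. X (Suc n) z - X n z) \<le> (1 / 3) ^ n"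
  obtains f where "f \<in> hardy2" "\<And>n. h2norm (\<lambda>z. f z - X n z) \<le> 3 / 2 * (1 / 3) ^ n"
proof -
  have dist: "h2norm (\<lambda>z. X (n + d) z - X n z) \<le> 3 / 2 * (1 / 3) ^ n - 3 / 2 * (1 / 3) ^ (n + d)" for n d
  proof (induction d)
    case 0
    have "h2norm (\<lambda>z. 0) = 0" by (simp add: h2norm_def taylor_coeff_const)
    then show ?case by simp
  next
    case (Suc d)
    have "h2norm (\<lambda>z. X (n + Suc d) z - X n z)
        \<le> h2norm (\<lambda>z. X (n + Suc d) z - X (n + d) z) + h2norm (\<lambda>z. X (n + d) z - X n z)"
      using h2norm_triangle[OF hardy2_diff[OF X X] hardy2_diff[OF X X], of "n + Suc d" "n + d" "n + d" n] by simp
    moreover have "h2norm (\<lambda>z. X (n + Suc d) z - X (n + d) z) \<le> (1 / 3) ^ (n + d)"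
      using step[of "n + d"] by simp
    moreover have "(1 / 3 :: real) ^ (n + Suc d) = (1 / 3) ^ (n + d) / 3" by simp
    ultimately show ?case using Suc.IH by linarith
  qed
  have coeff: "taylor_coeff (\<lambda>z. F z - G z) j = taylor_coeff F j - taylor_coeff G j"
    if "F \<in> hardy2" "G \<in> hardy2" for F G j
    using taylor_coeff_lincomb[OF hardy2_holomorphic[OF that(1)] hardy2_holomorphic[OF that(2)], of 1 "-1" j] by simp
  have "convergent (\<lambda>n. taylor_coeff (X n) j)" for j
  proof -
    have "summable (\<lambda>n. taylor_coeff (X (Suc n)) j - taylor_coeff (X n) j)"
    proof (rule summable_comparison_test'[where N = 0])
      show "summable (\<lambda>n. (1 / 3 :: real) ^ n)" by simp
      show "norm (taylor_coeff (X (Suc n)) j - taylor_coeff (X n) j) \<le> (1 / 3) ^ n" for n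
        using order_trans[OF hardy2_coeff_le[OF hardy2_diff[OF X X]] step] coeff[OF X X] by metis
    qed
    then have "convergent (\<lambda>N. \<Sum>n<N. taylor_coeff (X (Suc n)) j - taylor_coeff (X n) j)"
      unfolding summable_iff_convergent .
    then have "convergent (\<lambda>N. taylor_coeff (X N) j - taylor_coeff (X 0) j)"
      by (simp only: sum_lessThan_telescope[where f = "\<lambda>n. taylor_coeff (X n) j"])
    then show ?thesis using convergent_diff_const_right_iff by blast
  qed
  then obtain b where b: "\<And>j. (\<lambda>n. taylor_coeff (X n) j) \<longlonglongrightarrow> b j"
    unfolding convergent_def by metis
  have near: "(\<Sum>j<N. (cmod (b j - taylor_coeff (X n) j))\<^sup>2) \<le> (3 / 2 * (1 / 3) ^ n)\<^sup>2" for n N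
  proof (rule LIMSEQ_le_const2)
    show "(\<lambda>d. \<Sum>j<N. (cmod (taylor_coeff (X (d + n)) j - taylor_coeff (X n) j))\<^sup>2) \<longlonglongrightarrow> (\<Sum>j<N. (cmod (b j - taylor_coeff (X n) j))\<^sup>2)"
      by (intro tendsto_intros LIMSEQ_ignore_initial_segment b)
    have "(\<Sum>j<N. (cmod (taylor_coeff (X (d + n)) j - taylor_coeff (X n) j))\<^sup>2) \<le> (3 / 2 * (1 / 3) ^ n)\<^sup>2" for d
    proof -
      let ?D = "\<lambda>z. X (n + d) z - X n z"
      have D: "?D \<in> hardy2" by (intro hardy2_diff X)
      have "(\<Sum>j<N. (cmod (taylor_coeff ?D j))\<^sup>2) \<le> (h2norm ?D)\<^sup>2"
        using sum_le_suminf[OF hardy2_summable[OF D], of "{..<N}"] sums_unique[OF h2norm_sums[OF D]] by simp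
      also have "\<dots> \<le> (3 / 2 * (1 / 3) ^ n)\<^sup>2"
      proof (rule power_mono)
        have "(0::real) \<le> 3 / 2 * (1 / 3) ^ (n + d)" by simp
        then show "h2norm ?D \<le> 3 / 2 * (1 / 3) ^ n" using dist[of n d] by linarith
      qed simp
      finally show ?thesis by (simp add: coeff[OF X X] add.commute)
    qed
    then show "\<exists>M. \<forall>d\<ge>M. (\<Sum>j<N. (cmod (taylor_coeff (X (d + n)) j - taylor_coeff (X n) j))\<^sup>2) \<le> (3 / 2 * (1 / 3) ^ n)\<^sup>2"
      by blast
  qed
  from hardy2_from_coeffs[OF near[of 0]] obtain g where g: "g \<in> hardy2" "\<And>j. taylor_coeff g j = b j - taylor_coeff (X 0) j"
    by blast
  define f where "f = (\<lambda>z. g z + X 0 z)"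
  have f: "f \<in> hardy2" unfolding f_def by (intro hardy2_add g X)
  have tf: "taylor_coeff f j = b j" for j
    using taylor_coeff_lincomb[OF hardy2_holomorphic[OF g(1)] hardy2_holomorphic[OF X[of 0]], of 1 1 j] g(2)
    by (simp add: f_def)
  have "h2norm (\<lambda>z. f z - X n z) \<le> 3 / 2 * (1 / 3) ^ n" for n
  proof (rule power2_le_imp_le)
    have D: "(\<lambda>z. f z - X n z) \<in> hardy2" by (intro hardy2_diff f X)
    show "(h2norm (\<lambda>z. f z - X n z))\<^sup>2 \<le> (3 / 2 * (1 / 3) ^ n)\<^sup>2"
      using suminf_le_const[OF hardy2_summable[OF D]] near[where n = n] sums_unique[OF h2norm_sums[OF D]]
      by (simp add: coeff[OF f X] tf)
  qed simp
  with f show ?thesis by (intro that) auto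
qed

text \<open>
  Uniform boundedness by a gliding hump. At step \<open>n\<close> a multiple of norm \<open>3\<^sup>-\<^sup>n\<close> of the kernel at \<open>w n\<close>
  is added or subtracted, whichever makes the value at \<open>w n\<close> at least as large as that of the added term
  alone; so the earlier terms need not be small at \<open>w n\<close>. The tail can destroy at most half of
  this value, which still grows like \<open>(4/3)\<^sup>n\<close> because the kernel norms are at least \<open>4\<^sup>n\<close>.
\<close>
lemma model_space_has_unbounded_element:
  assumes \<Theta>: "inner_function \<Theta>" and large: "\<And>M. \<exists>w\<in>disk. kernel_growth \<Theta> w > M"
  obtains \<phi> where "\<phi> \<in> model_space \<Theta>" "\<not> bounded (\<phi> ` disk)"
proof -
  have "\<forall>n::nat. \<exists>w\<in>disk. kernel_growth \<Theta> w > (4 ^ n)\<^sup>2" using large by blast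
  then obtain w where w: "\<And>n::nat. w n \<in> disk" "\<And>n. kernel_growth \<Theta> (w n) > (4 ^ n)\<^sup>2" by metis
  define k where "k n = h2norm (model_kernel \<Theta> (w n))" for n
  have k2: "(k n)\<^sup>2 = kernel_growth \<Theta> (w n)" for n
    unfolding k_def by (rule model_kernel_h2norm[OF \<Theta> w(1)])
  have k: "4 ^ n \<le> k n" for n
    by (rule power2_le_imp_le) (use w(2)[of n] k2[of n] in \<open>auto simp: k_def\<close>)
  then have kpos: "0 < k n" for n by (meson less_le_trans zero_less_numeral zero_less_power)
  have eval: "cmod (f (w n)) \<le> k n * h2norm f" if "f \<in> model_space \<Theta>" for f n
    by (rule power2_le_imp_le)
      (use model_space_growth[OF \<Theta> w(1)[of n] that] kpos[of n] in \<open>simp_all add: power_mult_distrib k2\<close>)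
  have "\<exists>X. \<forall>n. X n \<in> model_space \<Theta> \<and> (h2norm (\<lambda>z. X (Suc n) z - X n z) \<le> (1 / 3) ^ n \<and>
      (1 / 3) ^ n * k n \<le> cmod (X (Suc n) (w n)))"
  proof (rule dependent_nat_choice)
    show "\<exists>x. x \<in> model_space \<Theta>" using model_space_zero[OF \<Theta>] by blast
    fix x n assume x: "x \<in> model_space \<Theta>"
    define c where "c = complex_of_real ((1 / 3) ^ n / k n)"
    define y where "y s = (\<lambda>z. 1 * x z + s * c * model_kernel \<Theta> (w n) z)" for s :: complex
    have yK: "y s \<in> model_space \<Theta>" for s
      unfolding y_def by (intro model_space_lincomb \<Theta> x model_kernel_in_model_space w)
    have ynorm: "h2norm (\<lambda>z. y s z - x z) \<le> (1 / 3) ^ n" if "cmod s = 1" for s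
    proof -
      have "h2norm (\<lambda>z. y s z - x z) = cmod (s * c) * k n"
        using h2norm_cmult[OF model_space_hardy2[OF model_kernel_in_model_space[OF \<Theta> w(1)]]]
        by (simp add: y_def k_def)
      then show ?thesis using that kpos[of n] by (simp add: c_def norm_mult norm_divide norm_power)
    qed
    have "model_kernel \<Theta> (w n) (w n) = of_real ((k n)\<^sup>2)"
      using model_kernel_reproducing[OF \<Theta> w(1) model_kernel_in_model_space[OF \<Theta> w(1)]]
        hardy2_inner_self[OF model_space_hardy2[OF model_kernel_in_model_space[OF \<Theta> w(1)]]]
      by (simp add: k_def)
    then have "c * model_kernel \<Theta> (w n) (w n) = of_real ((1 / 3) ^ n * k n)"
      using kpos[of n] by (simp add: c_def power2_eq_square)
    then have yw: "y s (w n) = x (w n) + s * of_real ((1 / 3) ^ n * k n)" for s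
      by (simp add: y_def mult.assoc)
    have "(1 / 3) ^ n * k n \<le> max (cmod (y 1 (w n))) (cmod (y (-1) (w n)))"
    proof -
      have "2 * ((1 / 3) ^ n * k n) = cmod (y 1 (w n) - y (-1) (w n))"
        using kpos[of n] by (simp add: yw norm_mult norm_power norm_divide)
      also have "\<dots> \<le> cmod (y 1 (w n)) + cmod (y (-1) (w n))"
        by (rule norm_triangle_ineq4)
      finally show ?thesis by linarith
    qed
    then obtain s where "s = 1 \<or> s = -1" "(1 / 3) ^ n * k n \<le> cmod (y s (w n))"
      by (metis le_max_iff_disj)
    then show "\<exists>y. y \<in> model_space \<Theta> \<and> (h2norm (\<lambda>z. y z - x z) \<le> (1 / 3) ^ n \<and> (1 / 3) ^ n * k n \<le> cmod (y (w n)))"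
      using yK ynorm by (intro exI[of _ "y s"]) auto
  qed
  then obtain X where X: "\<And>n. X n \<in> model_space \<Theta>" "\<And>n. h2norm (\<lambda>z. X (Suc n) z - X n z) \<le> (1 / 3) ^ n"
    "\<And>n. (1 / 3) ^ n * k n \<le> cmod (X (Suc n) (w n))" by blast
  obtain \<phi> where \<phi>: "\<phi> \<in> hardy2" "\<And>n. h2norm (\<lambda>z. \<phi> z - X n z) \<le> 3 / 2 * (1 / 3) ^ n"
    using hardy2_complete[OF model_space_hardy2[OF X(1)] X(2)] by blast
  have "(\<lambda>n. 3 / 2 * (1 / 3 :: real) ^ n) \<longlonglongrightarrow> 3 / 2 * 0"
    by (intro tendsto_intros LIMSEQ_realpow_zero) auto
  then have z: "(\<lambda>n. 3 / 2 * (1 / 3 :: real) ^ n) \<longlonglongrightarrow> 0" by simp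
  have "(\<lambda>n. h2norm (\<lambda>z. \<phi> z - X n z)) \<longlonglongrightarrow> 0"
    by (rule Lim_null_comparison[OF _ z]) (rule always_eventually, use \<phi>(2) in simp)
  from model_space_closed[OF \<Theta> \<phi>(1) X(1) this] have \<phi>K: "\<phi> \<in> model_space \<Theta>" .
  have low: "1 / 2 * (4 / 3) ^ n \<le> cmod (\<phi> (w n))" for n
  proof -
    have "(\<lambda>z. \<phi> z - X (Suc n) z) \<in> model_space \<Theta>"
      using model_space_lincomb[OF \<Theta> \<phi>K X(1), of 1 "-1" "Suc n"] by simp
    from eval[OF this, of n] have "cmod (\<phi> (w n) - X (Suc n) (w n)) \<le> k n * h2norm (\<lambda>z. \<phi> z - X (Suc n) z)" .
    also have "\<dots> \<le> k n * (3 / 2 * (1 / 3) ^ Suc n)"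
      using \<phi>(2)[of "Suc n"] kpos[of n] by (intro mult_left_mono) auto
    finally have "cmod (\<phi> (w n) - X (Suc n) (w n)) \<le> 1 / 2 * ((1 / 3) ^ n * k n)" by (simp add: mult.commute)
    then have "1 / 2 * ((1 / 3) ^ n * k n) \<le> cmod (\<phi> (w n))"
      using X(3)[of n] norm_triangle_ineq2[of "X (Suc n) (w n)" "\<phi> (w n)"] by (simp add: norm_minus_commute)
    moreover have "(1 / 3) ^ n * 4 ^ n \<le> (1 / 3) ^ n * k n"
      using k[of n] by (intro mult_left_mono) auto
    moreover have "(1 / 3) ^ n * 4 ^ n = (4 / 3 :: real) ^ n" by (simp flip: power_mult_distrib)
    ultimately show ?thesis by linarith
  qed
  have "\<not> bounded (\<phi> ` disk)"
  proof
    assume "bounded (\<phi> ` disk)"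
    then obtain B where B: "\<And>z. z \<in> disk \<Longrightarrow> cmod (\<phi> z) \<le> B" unfolding bounded_iff by blast
    obtain n where "2 * B < (4 / 3) ^ n" using real_arch_pow[of "4 / 3 :: real" "2 * B"] by auto
    with low[of n] B[OF w(1)[of n]] show False by simp
  qed
  with \<phi>K that show ?thesis by blast
qed

theorem theorem3p5:
  fixes u v I :: "complex \<Rightarrow> complex"
  assumes "inner_function u" and "inner_function v" and "inner_function I"
    and "\<not> u constant_on ball 0 1"
    and "\<forall>z\<in>ball 0 1. v z = u z * I z"
    and "boundary_spectrum u \<inter> boundary_spectrum I = {}"
  shows "multipliers u v = model_space (\<lambda>z. z * I z) \<and>
    (\<not> finite_blaschke_product I \<longrightarrow> (\<exists>\<phi>\<in>multipliers u v. \<not> bounded (\<phi> ` ball 0 1)))"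
proof (intro conjI impI)
  let ?\<Theta> = "\<lambda>z. z * I z"
  note u = assms(1) and I = assms(3)
  note \<Theta> = inner_function_mult[OF inner_function_id I]
  obtain C where C: "\<And>z. z \<in> disk \<Longrightarrow> kernel_growth u z \<le> C \<or> kernel_growth ?\<Theta> z \<le> C"
    using kernel_growths_not_both_large[OF u I assms(6)] by blast
  have mv: "model_space v = model_space (\<lambda>z. u z * I z)"
    by (rule model_space_cong) (use inner_function_hardy2_mult[OF inner_function_mult[OF u I]] assms(5) in auto)
  show eq: "multipliers u v = model_space ?\<Theta>"
  proof
    show "multipliers u v \<subseteq> model_space ?\<Theta>"
      using multipliers_subset_model_space[OF u I assms(4)] assms(5) by blast
    show "model_space ?\<Theta> \<subseteq> multipliers u v"
      using model_space_subset_multipliers[OF u I C] hardy2_holomorphic[OF model_space_hardy2]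
      by (auto simp: multipliers_def mv)
  qed
  assume nb: "\<not> finite_blaschke_product I"
  have "\<exists>w\<in>disk. kernel_growth ?\<Theta> w > M" for M
  proof -
    \<comment> \<open>This radius makes \<open>1 - |w|\<^sup>2\<close> at most \<open>1 / (2 (|M| + 1))\<close>, against a numerator of at least \<open>1/2\<close>.\<close>
    define r where "r = max (1 / 2) (1 - 1 / (4 * (\<bar>M\<bar> + 1)))"
    have r: "0 < r" "r < 1" by (auto simp: r_def)
    then obtain w where w: "w \<in> disk" "r \<le> cmod w" "cmod (I w) < 1 / 2"
      using finite_blaschke_product_if_bounded_below[OF I r, of "1 / 2"] nb by force
    have "cmod (w * I w) \<le> 1 / 2"
      using w mult_mono[of "cmod w" 1 "cmod (I w)" "1 / 2"] by (simp add: norm_mult)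
    then have "(cmod (w * I w))\<^sup>2 \<le> (1 / 2)\<^sup>2" by (intro power_mono) auto
    then have num: "1 / 2 \<le> 1 - (cmod (w * I w))\<^sup>2" by (simp add: power2_eq_square)
    have "1 - (cmod w)\<^sup>2 = (1 - cmod w) * (1 + cmod w)" by (simp add: power2_eq_square algebra_simps)
    also have "\<dots> \<le> (1 / (4 * (\<bar>M\<bar> + 1))) * 2"
      using w by (intro mult_mono) (auto simp: r_def)
    also have "\<dots> = 1 / (2 * (\<bar>M\<bar> + 1))" by (simp add: field_simps)
    finally have den: "1 - (cmod w)\<^sup>2 \<le> 1 / (2 * (\<bar>M\<bar> + 1))" .
    have pos: "0 < 1 - (cmod w)\<^sup>2" using w by (simp add: abs_square_less_1)
    have "M < (1 / 2) / (1 / (2 * (\<bar>M\<bar> + 1)))" by simp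
    also have "\<dots> \<le> (1 - (cmod (w * I w))\<^sup>2) / (1 - (cmod w)\<^sup>2)"
      using num den pos by (intro frac_le) auto
    finally show ?thesis using w(1) unfolding kernel_growth_def by blast
  qed
  from model_space_has_unbounded_element[OF \<Theta> this] show "\<exists>\<phi>\<in>multipliers u v. \<not> bounded (\<phi> ` ball 0 1)"
    unfolding eq by blast
qed

end
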